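(* Let $(\Omega,\mathcal{H},\mathbb{E})$ be a sublinear expectation space over a measurable space $(\Omega,\mathcal{F})$, where $\mathbb{E}$ is lower-continuous, and let $V(A):=\mathbb{E}[I_A]$, $A\in\mathcal{F}$, be the induced capacity. Let $\mathcal{P}$ be a family of $\sigma$-additive probability measures on $(\Omega,\mathcal{F})$ representing $\mathbb{E}$, i.e. $\mathbb{E}[X]=\sup_{Q\in\mathcal{P}}E_Q[X]$ for each $X\in\mathcal{H}$. Let $\{X_n\}_{n=1}^\infty$ be a sequence of independent and identically distributed (in the sense of sublinear expectations) non-negative random variables in $\mathcal{H}$. Suppose that $$\sum_{k=0}^{\infty}\ \sup_{Q\in\mathcal{P}}\int_{(k,k+1]} x\,\mathrm{d}F_Q(x)<\infty,$$ where $F_Q(x)=Q(X_1\le x)$ is the distribution function of $X_1$ under $Q$. Then, for $S_n=\sum_{i=1}^n X_i$, $$V\left(\left\{\limsup_{n\to\infty}\frac{S_n}{n}>\mathbb{E}[X_1]\right\}\cup\left\{\liminf_{n\to\infty}\frac{S_n}{n}<-\mathbb{E}[-X_1]\right\}\right)=0.$$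
   Context: Setting. $(\Omega,\mathcal{F})$ is a measurable space. $\mathcal{H}$ is a subset of all random variables on $(\Omega,\mathcal{F})$ such that $I_M\in\mathcal{H}$ for all $M\in\mathcal{F}$ (where $I_M$ is the indicator function), and if $X_1,\dots,X_n\in\mathcal{H}$ then $\varphi(X_1,\dots,X_n)\in\mathcal{H}$ for each $\varphi\in C_{l,\mathrm{Lip}}(\mathbb{R}^n)$. Here $C_{l,\mathrm{Lip}}(\mathbb{R}^n)$ is the linear space of locally Lipschitz functions $\varphi$ satisfying $|\varphi(x)-\varphi(y)|\le C(1+|x|^m+|y|^m)|x-y|$ for all $x,y\in\mathbb{R}^n$, with $C>0$ and $m\in\mathbb{N}$ depending on $\varphi$. Sublinear expectation. A sublinear expectation on $\mathcal{H}$ is a functional $\mathbb{E}:\mathcal{H}\to[-\infty,+\infty]$ such that for all $X,Y\in\mathcal{H}$: (a) if $X\ge Y$ then $\mathbb{E}[X]\ge\mathbb{E}[Y]$; (b) $\mathbb{E}[c]=c$ for all $c\in\mathbb{R}$; (c) $\mathbb{E}[\lambda X]=\lambda\mathbb{E}[X]$ for all $\lambda\ge0$; (d) $\mathbb{E}[X+Y]\le\mathbb{E}[X]+\mathbb{E}[Y]$, provided $\mathbb{E}[X]+\mathbb{E}[Y]$ is not of the form $\infty-\infty$ or $-\infty+\infty$. The triple $(\Omega,\mathcal{H},\mathbb{E})$ is then called a sublinear expectation space. Lower-continuity. $\mathbb{E}$ is lower-continuous if $X_n\uparrow X$ implies $\mathbb{E}[X_n]\uparrow\mathbb{E}[X]$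 whenever $0\le X_n,X\in\mathcal{H}$. Representation. Throughout, the representing family $\mathcal{P}$ consists of $\sigma$-additive (countably additive) probability measures on $(\Omega,\mathcal{F})$ with $\mathbb{E}[X]=\sup_{Q\in\mathcal{P}}E_Q[X]$ for each $X\in\mathcal{H}$, where $E_Q$ is the usual expectation under $Q$. Independence. For random vectors $\boldsymbol{X}=(X_1,\dots,X_m)$ and $\boldsymbol{Y}=(Y_1,\dots,Y_n)$ with components in $\mathcal{H}$, $\boldsymbol{Y}$ is independent of $\boldsymbol{X}$ if for each $\varphi\in C_{l,\mathrm{Lip}}(\mathbb{R}^m\times\mathbb{R}^n)$, $$\mathbb{E}[\varphi(\boldsymbol{X},\boldsymbol{Y})]=\mathbb{E}\bigl[\mathbb{E}[\varphi(\boldsymbol{x},\boldsymbol{Y})]\big|_{\boldsymbol{x}=\boldsymbol{X}}\bigr],$$ provided that $\bar\varphi(\boldsymbol{x}):=\mathbb{E}[|\varphi(\boldsymbol{x},\boldsymbol{Y})|]<\infty$ for all $\boldsymbol{x}$ and $\mathbb{E}[|\bar\varphi(\boldsymbol{X})|]<\infty$. A sequence $\{X_n\}_{n=1}^\infty$ is a sequence of independent random variables if $X_{n+1}$ is independent of $(X_1,\dots,X_n)$ for each $n\ge1$. Identical distribution. Two $n$-dimensional random vectors $\boldsymbol{X}_1,\boldsymbol{X}_2$ on sublinear expectation spaces $(\Omega_1,\mathcal{H}_1,\mathbb{E}_1)$, $(\Omega_2,\mathcal{H}_2,\mathbb{E}_2)$ are identically distributed if $\mathbb{E}_1[\varphi(\boldsymbol{X}_1)]=\mathbb{E}_2[\varphi(\boldsymbol{X}_2)]$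 for all $\varphi\in C_{l,\mathrm{Lip}}(\mathbb{R}^n)$, provided the corresponding sublinear expectations are finite. *)

theory Defs
  imports "HOL-Probability.Probability"
begin

text \<open>
  Vectors in \<open>\<real>\<^sup>n\<close>, for varying \<open>n\<close>, are lists of length \<open>n\<close>; the values of a function at lists of
  other lengths are irrelevant. The growth condition entails local Lipschitz continuity.
\<close>

definition C_lLip :: "nat \<Rightarrow> (real list \<Rightarrow> real) set" where
  "C_lLip n = {\<phi>. \<exists>C>0. \<exists>m::nat. \<forall>x y. length x = n \<longrightarrow> length y = n \<longrightarrow>
     \<bar>\<phi> x - \<phi> y\<bar> \<le> C * (1 + L2_set (\<lambda>i. x ! i) {..<n} ^ m + L2_set (\<lambda>i. y ! i) {..<n} ^ m)
                     * L2_set (\<lambda>i. x ! i - y ! i) {..<n}}"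

definition rvec :: "('a \<Rightarrow> real) list \<Rightarrow> 'a \<Rightarrow> real list" where
  "rvec Xs \<omega> = map (\<lambda>X. X \<omega>) Xs"

text \<open>
  \<open>E\<close> is a total function in the logic, but only its values on \<open>H\<close> are meaningful. Only the space
  and the sigma-algebra of \<open>M\<close> matter.
\<close>

locale sublinear_expectation_space =
  fixes M :: "'a measure" and H :: "('a \<Rightarrow> real) set" and E :: "('a \<Rightarrow> real) \<Rightarrow> ereal"
  assumes random_variables: "H \<subseteq> borel_measurable M"
    and indicator_in_H: "A \<in> sets M \<Longrightarrow> indicator A \<in> H"
    and C_lLip_in_H: "Xs \<noteq> [] \<Longrightarrow> set Xs \<subseteq> H \<Longrightarrow> \<phi> \<in> C_lLip (length Xs) \<Longrightarrow> (\<lambda>\<omega>. \<phi> (rvec Xs \<omega>)) \<in> H"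
    and E_mono: "X \<in> H \<Longrightarrow> Y \<in> H \<Longrightarrow> (\<And>\<omega>. \<omega> \<in> space M \<Longrightarrow> X \<omega> \<ge> Y \<omega>) \<Longrightarrow> E X \<ge> E Y"
    and E_const: "E (\<lambda>\<omega>. c) = ereal c"
    and E_scale: "X \<in> H \<Longrightarrow> l \<ge> 0 \<Longrightarrow> E (\<lambda>\<omega>. l * X \<omega>) = ereal l * E X"
    and E_subadd: "X \<in> H \<Longrightarrow> Y \<in> H \<Longrightarrow>
      \<not> (E X = \<infinity> \<and> E Y = -\<infinity>) \<Longrightarrow> \<not> (E X = -\<infinity> \<and> E Y = \<infinity>) \<Longrightarrow>
      E (\<lambda>\<omega>. X \<omega> + Y \<omega>) \<le> E X + E Y"

definition lower_continuous ::
    "'a measure \<Rightarrow> ('a \<Rightarrow> real) set \<Rightarrow> (('a \<Rightarrow> real) \<Rightarrow> ereal) \<Rightarrow> bool" where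
  "lower_continuous M H E \<longleftrightarrow>
    (\<forall>X Y. (\<forall>n::nat. X n \<in> H) \<longrightarrow> Y \<in> H \<longrightarrow>
       (\<forall>\<omega>\<in>space M. (\<forall>n. 0 \<le> X n \<omega>) \<and> 0 \<le> Y \<omega> \<and>
          incseq (\<lambda>n. X n \<omega>) \<and> (\<lambda>n. X n \<omega>) \<longlonglongrightarrow> Y \<omega>) \<longrightarrow>
       incseq (\<lambda>n. E (X n)) \<and> (\<lambda>n. E (X n)) \<longlonglongrightarrow> E Y)"

definition capacity :: "(('a \<Rightarrow> real) \<Rightarrow> ereal) \<Rightarrow> 'a set \<Rightarrow> ereal" where
  "capacity E A = E (indicator A)"

text \<open>
  The expectation with values in the extended reals, which exists unless the expectations of the
  positive and the negative part are both infinite. Note that \<open>ennreal\<close> truncates negative numbers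
  to \<open>0\<close>.
\<close>

definition expect_exists :: "'a measure \<Rightarrow> ('a \<Rightarrow> real) \<Rightarrow> bool" where
  "expect_exists Q X \<longleftrightarrow>
     (\<integral>\<^sup>+\<omega>. ennreal (X \<omega>) \<partial>Q) < \<infinity> \<or> (\<integral>\<^sup>+\<omega>. ennreal (- X \<omega>) \<partial>Q) < \<infinity>"

definition expect :: "'a measure \<Rightarrow> ('a \<Rightarrow> real) \<Rightarrow> ereal" where
  "expect Q X = enn2ereal (\<integral>\<^sup>+\<omega>. ennreal (X \<omega>) \<partial>Q) - enn2ereal (\<integral>\<^sup>+\<omega>. ennreal (- X \<omega>) \<partial>Q)"

text \<open>
  The identity \<open>E X = (SUP Q\<in>P. expect Q X)\<close> is required wherever its right-hand side is meaningful.
  Demanding instead that all expectations exist would force every member of \<open>H\<close> to have finite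
  moments of all orders under every \<open>Q\<close>, since \<open>H\<close> contains oscillating functions of polynomial
  growth of its members.
\<close>

definition represents ::
    "'a measure \<Rightarrow> ('a \<Rightarrow> real) set \<Rightarrow> (('a \<Rightarrow> real) \<Rightarrow> ereal) \<Rightarrow> 'a measure set \<Rightarrow> bool" where
  "represents M H E P \<longleftrightarrow>
     (\<forall>Q\<in>P. prob_space Q \<and> sets Q = sets M) \<and>
     (\<forall>X\<in>H. (\<forall>Q\<in>P. expect_exists Q X) \<longrightarrow> E X = (SUP Q\<in>P. expect Q X))"

text \<open>
  \<open>Ys\<close> is independent of \<open>Xs\<close>. The partial expectation \<open>\<psi>\<close> is real-valued when \<open>E \<bar>\<phi>(x, Ys)\<bar>\<close> is finite
  for all \<open>x\<close>, but it need not be locally Lipschitz; the defining identity only makes sense if the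
  random variables to which the outer \<open>E\<close> is applied belong to its domain \<open>H\<close>.
\<close>

definition indep_of ::
    "('a \<Rightarrow> real) set \<Rightarrow> (('a \<Rightarrow> real) \<Rightarrow> ereal) \<Rightarrow> ('a \<Rightarrow> real) list \<Rightarrow> ('a \<Rightarrow> real) list \<Rightarrow> bool" where
  "indep_of H E Ys Xs \<longleftrightarrow>
    (\<forall>\<phi>\<in>C_lLip (length Xs + length Ys).
       let \<phi>bar = (\<lambda>x. E (\<lambda>\<omega>. \<bar>\<phi> (x @ rvec Ys \<omega>)\<bar>));
           \<psi> = (\<lambda>x. E (\<lambda>\<omega>. \<phi> (x @ rvec Ys \<omega>)));
           Z = (\<lambda>\<omega>. \<bar>real_of_ereal (\<phi>bar (rvec Xs \<omega>))\<bar>);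
           W = (\<lambda>\<omega>. real_of_ereal (\<psi> (rvec Xs \<omega>)))
       in (\<forall>x. length x = length Xs \<longrightarrow> \<phi>bar x < \<infinity>) \<longrightarrow> Z \<in> H \<longrightarrow> E Z < \<infinity> \<longrightarrow> W \<in> H \<longrightarrow>
          E (\<lambda>\<omega>. \<phi> (rvec Xs \<omega> @ rvec Ys \<omega>)) = E W)"

definition independent_seq ::
    "('a \<Rightarrow> real) set \<Rightarrow> (('a \<Rightarrow> real) \<Rightarrow> ereal) \<Rightarrow> (nat \<Rightarrow> 'a \<Rightarrow> real) \<Rightarrow> bool" where
  "independent_seq H E X \<longleftrightarrow> (\<forall>n\<ge>1. indep_of H E [X (Suc n)] (map X [1..<Suc n]))"

definition identically_distributed ::
    "(('a \<Rightarrow> real) \<Rightarrow> ereal) \<Rightarrow> ('a \<Rightarrow> real) list \<Rightarrow>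
     (('b \<Rightarrow> real) \<Rightarrow> ereal) \<Rightarrow> ('b \<Rightarrow> real) list \<Rightarrow> bool" where
  "identically_distributed E1 Xs E2 Ys \<longleftrightarrow> length Xs = length Ys \<and>
    (\<forall>\<phi>\<in>C_lLip (length Xs).
       \<bar>E1 (\<lambda>\<omega>. \<phi> (rvec Xs \<omega>))\<bar> \<noteq> \<infinity> \<longrightarrow> \<bar>E2 (\<lambda>\<omega>. \<phi> (rvec Ys \<omega>))\<bar> \<noteq> \<infinity> \<longrightarrow>
       E1 (\<lambda>\<omega>. \<phi> (rvec Xs \<omega>)) = E2 (\<lambda>\<omega>. \<phi> (rvec Ys \<omega>)))"

definition distribution_function :: "'a measure \<Rightarrow> ('a \<Rightarrow> real) \<Rightarrow> real \<Rightarrow> real" where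
  "distribution_function Q X x = measure Q {\<omega>\<in>space Q. X \<omega> \<le> x}"

end

theory Submission
  imports Defs
begin

text \<open>
  The capacity of an event is the supremum of its probabilities under the representing measures
  (\<open>capacity_eq_0_if_AE\<close>), so it suffices to prove both bounds almost surely under each measure \<open>Q\<close> of
  the family. The variables need not be independent under \<open>Q\<close>, so all moment estimates have to be made
  for \<open>E\<close> and are then transferred to \<open>Q\<close> by \<open>E_Q \<le> E\<close>.

  The proof adapts Etemadi's argument. Its variance estimate is not available, since the summands can
  only be centred so that their upper expectations vanish, while the lower ones may be negative. For the
  positive part of the sum there is a substitute: if \<open>E (g\<^sub>i (X\<^sub>i)) = 0\<close> for all \<open>i\<close> then
  \<open>E (((\<Sum>i\<le>n. g\<^sub>i (X\<^sub>i))\<^sup>+)\<^sup>2) \<le> (\<Sum>i\<le>n. E ((g\<^sub>i (X\<^sub>i))\<^sup>2))\<close>, because the positive part of the earlier sum,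
  multiplied by the next centred variable, has upper expectation \<open>0\<close>
  (\<open>E_pos_part_mult_centred\<close>, \<open>E_pos_part_sum_sq_le\<close>). Along a geometric subsequence these bounds are
  summable after normalisation, as soon as the second moments divided by \<open>i\<^sup>2\<close> are, and so the
  normalised positive parts tend to \<open>0\<close> almost surely (\<open>AE_geometric_means_pos_part\<close>). As the
  variables are non-negative, the partial sums are monotone, which extends the bounds to all indices
  up to a factor \<open>\<alpha>\<close> that is arbitrarily close to \<open>1\<close> (\<open>mean_limsup_le\<close>, \<open>mean_liminf_ge\<close>).

  For the upper bound, \<open>X\<^sub>i\<close> is truncated at \<open>i\<close>. The hypothesis on the blocks \<open>(k, k + 1]\<close> gives
  \<open>(\<Sum>i. E ((min X\<^sub>i i)\<^sup>2) / i\<^sup>2) < \<infinity>\<close> (\<open>summable_sq_weight_averages\<close>), which both feeds the variance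
  estimate and shows that almost surely only finitely many \<open>X\<^sub>i\<close> are truncated. For the lower bound, the
  same estimate is applied to \<open>- min X\<^sub>i c\<close> with a fixed \<open>c\<close>, and \<open>c\<close> tends to infinity; the
  hypothesis gives the uniform integrability that makes the lower expectations converge
  (\<open>neg_E_neg_le_trunc\<close>).
\<close>

section \<open>Bounded Lipschitz functions\<close>

text \<open>
  Bounded Lipschitz functions, on the line and on lists of a fixed length, serve as test functions
  throughout. They form an algebra, so products of them are still admissible in the definition of
  independence, and boundedness keeps all sublinear expectations finite, so that subadditivity
  applies without a case distinction.
\<close>

definition bdd_lip :: "('b \<Rightarrow> 'b \<Rightarrow> real) \<Rightarrow> 'b set \<Rightarrow> ('b \<Rightarrow> real) set" where
  "bdd_lip d S = {f. \<exists>K\<ge>0. \<forall>x\<in>S. \<forall>y\<in>S. \<bar>f x\<bar> \<le> K \<and> \<bar>f x - f y\<bar> \<le> K * d x y}"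

abbreviation l2_dist :: "nat \<Rightarrow> real list \<Rightarrow> real list \<Rightarrow> real" where
  "l2_dist n x y \<equiv> L2_set (\<lambda>i. x ! i - y ! i) {..<n}"

abbreviation bdd_lip_vec :: "nat \<Rightarrow> (real list \<Rightarrow> real) set" where
  "bdd_lip_vec n \<equiv> bdd_lip (l2_dist n) {x. length x = n}"

abbreviation bdd_lip_real :: "(real \<Rightarrow> real) set" where
  "bdd_lip_real \<equiv> bdd_lip dist UNIV"

lemma bdd_lip_const:
  assumes "\<And>x y. 0 \<le> d x y"
  shows "(\<lambda>x. c) \<in> bdd_lip d S"
  unfolding bdd_lip_def using assms by (auto intro!: exI[of _ "\<bar>c\<bar>"])

lemma bdd_lip_add:
  assumes "f \<in> bdd_lip d S" "g \<in> bdd_lip d S"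
  shows "(\<lambda>x. f x + g x) \<in> bdd_lip d S"
proof -
  obtain K L where K: "K \<ge> 0" "\<forall>x\<in>S. \<forall>y\<in>S. \<bar>f x\<bar> \<le> K \<and> \<bar>f x - f y\<bar> \<le> K * d x y"
    and L: "L \<ge> 0" "\<forall>x\<in>S. \<forall>y\<in>S. \<bar>g x\<bar> \<le> L \<and> \<bar>g x - g y\<bar> \<le> L * d x y"
    using assms unfolding bdd_lip_def by blast
  have "\<bar>f x + g x\<bar> \<le> K + L \<and> \<bar>(f x + g x) - (f y + g y)\<bar> \<le> (K + L) * d x y"
    if "x \<in> S" "y \<in> S" for x y
    using K(2)[rule_format, OF that] L(2)[rule_format, OF that] by (auto simp: distrib_right)
  then show ?thesis
    unfolding bdd_lip_def using K(1) L(1) by (auto intro!: exI[of _ "K + L"])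
qed

lemma bdd_lip_mult:
  assumes "f \<in> bdd_lip d S" "g \<in> bdd_lip d S"
  shows "(\<lambda>x. f x * g x) \<in> bdd_lip d S"
proof -
  obtain K L where K: "K \<ge> 0" "\<forall>x\<in>S. \<forall>y\<in>S. \<bar>f x\<bar> \<le> K \<and> \<bar>f x - f y\<bar> \<le> K * d x y"
    and L: "L \<ge> 0" "\<forall>x\<in>S. \<forall>y\<in>S. \<bar>g x\<bar> \<le> L \<and> \<bar>g x - g y\<bar> \<le> L * d x y"
    using assms unfolding bdd_lip_def by blast
  have "\<bar>f x * g x\<bar> \<le> 2 * K * L \<and> \<bar>f x * g x - f y * g y\<bar> \<le> (2 * K * L) * d x y"
    if x: "x \<in> S" and y: "y \<in> S" for x y
  proof
    have "\<bar>f x * g x\<bar> \<le> K * L"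
      unfolding abs_mult using K L x by (intro mult_mono) auto
    also have "\<dots> \<le> 2 * K * L" using K(1) L(1) by simp
    finally show "\<bar>f x * g x\<bar> \<le> 2 * K * L" .
    have "f x * g x - f y * g y = f x * (g x - g y) + (f x - f y) * g y"
      by (simp add: algebra_simps)
    then have "\<bar>f x * g x - f y * g y\<bar> \<le> \<bar>f x\<bar> * \<bar>g x - g y\<bar> + \<bar>f x - f y\<bar> * \<bar>g y\<bar>"
      by (metis abs_mult abs_triangle_ineq)
    also have "\<dots> \<le> K * (L * d x y) + (K * d x y) * L"
      using K L x y by (intro add_mono mult_mono) (auto intro: order_trans[OF abs_ge_zero])
    finally show "\<bar>f x * g x - f y * g y\<bar> \<le> (2 * K * L) * d x y" by (simp add: algebra_simps)
  qed
  then show ?thesis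
    unfolding bdd_lip_def using K(1) L(1) by (auto intro!: exI[of _ "2 * K * L"])
qed

lemma bdd_lip_contraction:
  fixes h :: "real \<Rightarrow> real"
  assumes "f \<in> bdd_lip d S" and h: "h 0 = 0" "\<And>a b. \<bar>h a - h b\<bar> \<le> \<bar>a - b\<bar>"
  shows "(\<lambda>x. h (f x)) \<in> bdd_lip d S"
proof -
  have "\<bar>h a\<bar> \<le> \<bar>a\<bar>" for a using h(2)[of a 0] h(1) by simp
  then show ?thesis
    using assms(1) h(2) unfolding bdd_lip_def mem_Collect_eq by (meson order_trans)
qed

lemma bdd_lip_sum:
  assumes "\<And>i. i \<in> A \<Longrightarrow> f i \<in> bdd_lip d S" "\<And>x y. 0 \<le> d x y"
  shows "(\<lambda>x. \<Sum>i\<in>A. f i x) \<in> bdd_lip d S"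
  using assms(1)
proof (induction A rule: infinite_finite_induct)
  case (insert i A)
  then show ?case by (simp add: bdd_lip_add)
qed (simp_all add: bdd_lip_const assms(2))

lemma bdd_lip_vec_coordinate:
  assumes "g \<in> bdd_lip_real" "i < n"
  shows "(\<lambda>x. g (x ! i)) \<in> bdd_lip_vec n"
proof -
  obtain K where K: "K \<ge> 0" "\<And>a b. \<bar>g a\<bar> \<le> K \<and> \<bar>g a - g b\<bar> \<le> K * dist a b"
    using assms(1) unfolding bdd_lip_def by auto
  have "\<bar>g (x ! i) - g (y ! i)\<bar> \<le> K * l2_dist n x y" for x y
  proof -
    have "\<bar>x ! i - y ! i\<bar> \<le> L2_set (\<lambda>i. \<bar>x ! i - y ! i\<bar>) {..<n}"
      using assms(2) by (intro member_le_L2_set) auto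
    also have "\<dots> = l2_dist n x y" by (simp add: L2_set_def)
    finally have "K * dist (x ! i) (y ! i) \<le> K * l2_dist n x y"
      using K(1) by (simp add: dist_real_def mult_left_mono)
    then show ?thesis using K(2)[of "x ! i" "y ! i"] by linarith
  qed
  then show ?thesis using K unfolding bdd_lip_def by auto
qed

lemma lipschitz_in_C_lLip:
  assumes "K \<ge> 0"
    and "\<And>x y. length x = n \<Longrightarrow> length y = n \<Longrightarrow> \<bar>\<phi> x - \<phi> y\<bar> \<le> K * l2_dist n x y"
  shows "\<phi> \<in> C_lLip n"
proof -
  have "\<bar>\<phi> x - \<phi> y\<bar> \<le> (K + 1) * (1 + L2_set (\<lambda>i. x ! i) {..<n} ^ 0 + L2_set (\<lambda>i. y ! i) {..<n} ^ 0)
     * l2_dist n x y" if "length x = n" "length y = n" for x y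
  proof -
    have "K * l2_dist n x y \<le> ((K + 1) * 3) * l2_dist n x y"
      using assms(1) by (intro mult_right_mono) (auto simp: L2_set_nonneg)
    with assms(2)[OF that] show ?thesis by simp
  qed
  then show ?thesis
    unfolding C_lLip_def using assms(1)
    by (intro CollectI exI[of _ "K + 1"] conjI exI[of _ 0] allI impI) auto
qed

lemma bdd_lip_vec_in_C_lLip: "\<phi> \<in> bdd_lip_vec n \<Longrightarrow> \<phi> \<in> C_lLip n"
  unfolding bdd_lip_def by (auto intro!: lipschitz_in_C_lLip)

text \<open>
  For \<open>x \<ge> 0\<close> this is \<open>min x c\<close>; the cut at \<open>0\<close> makes the function bounded on the whole line.
\<close>

definition trunc :: "real \<Rightarrow> real \<Rightarrow> real" where
  "trunc c x = max 0 (min x c)"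

lemma trunc_bdd_lip:
  assumes "0 \<le> c"
  shows "trunc c \<in> bdd_lip_real"
proof -
  have "\<bar>trunc c x - trunc c y\<bar> \<le> 1 * \<bar>x - y\<bar>" for x y
    using assms by (auto simp: trunc_def max_def min_def)
  moreover have "1 * \<bar>x - y\<bar> \<le> max 1 c * \<bar>x - y\<bar>" for x y :: real
    by (intro mult_right_mono) auto
  ultimately have "\<bar>trunc c x - trunc c y\<bar> \<le> max 1 c * \<bar>x - y\<bar>" for x y
    by (meson order_trans)
  moreover have "\<bar>trunc c x\<bar> \<le> max 1 c" for x using assms by (auto simp: trunc_def)
  ultimately show ?thesis
    unfolding bdd_lip_def dist_real_def by (auto intro!: exI[of _ "max 1 c"])
qed

section \<open>Means along a geometric subsequence\<close>

lemma geometric_bracket: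
  fixes \<alpha> x :: real
  assumes "1 < \<alpha>" "\<alpha> ^ N \<le> x"
  obtains n where "N \<le> n" "\<alpha> ^ n \<le> x" "x < \<alpha> ^ Suc n"
proof -
  define k where "k = (LEAST k. x < \<alpha> ^ k)"
  have k: "x < \<alpha> ^ k"
    unfolding k_def using real_arch_pow[OF assms(1)] by (rule LeastI_ex)
  then have "\<alpha> ^ N < \<alpha> ^ k" using assms(2) by simp
  then have "N < k" using assms(1) power_less_imp_less_exp by blast
  then obtain n where n: "k = Suc n" "N \<le> n" by (cases k) auto
  moreover have "\<not> x < \<alpha> ^ n"
    using not_less_Least[of n "\<lambda>k. x < \<alpha> ^ k"] n unfolding k_def[symmetric] by auto
  ultimately show thesis using that[of n] k by auto
qed

text \<open>
  Etemadi's interpolation. The partial sums of the non-negative numbers \<open>y\<close> are monotone, so for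
  \<open>\<alpha>\<^sup>n \<le> m < \<alpha>\<^sup>n\<^sup>+\<^sup>1\<close> the sum up to \<open>m\<close> is at most the sum up to \<open>\<alpha>\<^sup>n\<^sup>+\<^sup>1\<close>, which costs a factor \<open>\<alpha>\<close> in
  the mean. Control along powers of \<open>\<alpha>\<close> therefore suffices, provided that \<open>\<alpha>\<close> can be taken close to
  \<open>1\<close>. The finitely many \<open>i\<close> with \<open>x i > y i\<close> contribute a constant, which vanishes after division by \<open>m\<close>.
\<close>

lemma mean_limsup_le:
  fixes x y e :: "nat \<Rightarrow> real"
  assumes \<alpha>: "1 < \<alpha>" and \<mu>: "0 \<le> \<mu>" "\<And>i. 1 \<le> i \<Longrightarrow> e i \<le> \<mu>"
    and y: "\<And>i. 1 \<le> i \<Longrightarrow> 0 \<le> y i" and x: "\<And>i. 1 \<le> i \<Longrightarrow> 0 \<le> x i"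
    and ev: "\<forall>\<^sub>F i in sequentially. x i \<le> y i"
    and lim: "(\<lambda>n. max 0 (\<Sum>i=1..nat \<lfloor>\<alpha> ^ n\<rfloor>. y i - e i) / \<alpha> ^ n) \<longlonglongrightarrow> 0"
  shows "limsup (\<lambda>m. ereal ((\<Sum>i=1..m. x i) / real m)) \<le> ereal (\<alpha> * \<mu>)"
proof (rule ereal_le_epsilon2)
  fix \<epsilon>' :: real assume "0 < \<epsilon>'"
  define \<epsilon> where "\<epsilon> = \<epsilon>' / (\<alpha> + 1)"
  have \<epsilon>: "0 < \<epsilon>" "(\<alpha> + 1) * \<epsilon> = \<epsilon>'" using \<open>0 < \<epsilon>'\<close> \<alpha> by (auto simp: \<epsilon>_def)
  obtain N0 where N0: "\<And>i. N0 \<le> i \<Longrightarrow> x i \<le> y i"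
    using ev unfolding eventually_sequentially by auto
  define C where "C = (\<Sum>i=1..N0. x i)"
  have sumx: "(\<Sum>i=1..m. x i) \<le> C + (\<Sum>i=1..m. y i)" for m
  proof -
    have "(\<Sum>i=1..m. x i) \<le> (\<Sum>i=1..m. (if i \<le> N0 then x i else 0) + y i)"
      using N0 y by (intro sum_mono) auto
    also have "\<dots> = (\<Sum>i | i \<in> {1..m} \<and> i \<le> N0. x i) + (\<Sum>i=1..m. y i)"
      unfolding sum.distrib by (subst sum.inter_filter) simp_all
    also have "(\<Sum>i | i \<in> {1..m} \<and> i \<le> N0. x i) \<le> C"
      unfolding C_def using x by (intro sum_mono2) auto
    finally show ?thesis by simp
  qed
  obtain N1 where N1: "\<And>n. N1 \<le> n \<Longrightarrow> max 0 (\<Sum>i=1..nat \<lfloor>\<alpha> ^ n\<rfloor>. y i - e i) / \<alpha> ^ n < \<epsilon>"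
    using order_tendstoD(2)[OF lim \<epsilon>(1)] unfolding eventually_sequentially by auto
  have bound: "(\<Sum>i=1..m. x i) / real m \<le> \<alpha> * \<mu> + \<epsilon>'"
    if m: "\<alpha> ^ N1 \<le> real m" "C / \<epsilon> \<le> real m" "1 \<le> m" for m
  proof -
    obtain n where n: "N1 \<le> n" "\<alpha> ^ n \<le> real m" "real m < \<alpha> ^ Suc n"
      using geometric_bracket[OF \<alpha> m(1)] by blast
    let ?k = "nat \<lfloor>\<alpha> ^ Suc n\<rfloor>"
    have pos: "0 < \<alpha> ^ Suc n" using \<alpha> by simp
    have k: "real ?k \<le> \<alpha> ^ Suc n" using pos by linarith
    have mk: "m \<le> ?k" using n(3) by linarith
    have "(\<Sum>i=1..?k. y i - e i) \<le> \<epsilon> * \<alpha> ^ Suc n"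
      using N1[of "Suc n"] n(1) pos by (simp add: field_simps)
    moreover have "(\<Sum>i=1..?k. e i) \<le> (\<Sum>i=1..?k. \<mu>)" using \<mu> by (intro sum_mono) auto
    moreover have "(\<Sum>i=1..?k. \<mu>) \<le> \<mu> * \<alpha> ^ Suc n"
      using mult_left_mono[OF k \<mu>(1)] by (simp add: mult.commute)
    moreover have "(\<Sum>i=1..m. y i) \<le> (\<Sum>i=1..?k. y i)"
      using mk y by (intro sum_mono2) auto
    ultimately have "(\<Sum>i=1..m. y i) \<le> (\<mu> + \<epsilon>) * \<alpha> ^ Suc n"
      by (simp add: sum_subtractf algebra_simps)
    also have "\<dots> = (\<alpha> * (\<mu> + \<epsilon>)) * \<alpha> ^ n" by simp
    also have "\<dots> \<le> (\<alpha> * (\<mu> + \<epsilon>)) * real m"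
      using n(2) \<alpha> \<mu>(1) \<epsilon>(1) by (intro mult_left_mono) auto
    finally have "(\<Sum>i=1..m. x i) \<le> \<epsilon> * real m + (\<alpha> * (\<mu> + \<epsilon>)) * real m"
      using sumx[of m] m(2) \<epsilon>(1) by (simp add: field_simps)
    also have "\<dots> = (\<alpha> * \<mu> + \<epsilon>') * real m" unfolding \<epsilon>(2)[symmetric] by (simp add: algebra_simps)
    finally show ?thesis using m(3) by (simp add: field_simps)
  qed
  have "\<forall>\<^sub>F m in sequentially. (\<Sum>i=1..m. x i) / real m \<le> \<alpha> * \<mu> + \<epsilon>'"
    using eventually_conj[OF eventually_conj[OF
        filterlim_at_top[THEN iffD1, OF filterlim_real_sequentially, rule_format, of "\<alpha> ^ N1"]
        filterlim_at_top[THEN iffD1, OF filterlim_real_sequentially, rule_format, of "C / \<epsilon>"]]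
        eventually_ge_at_top[of 1]]
    by eventually_elim (use bound in auto)
  then show "limsup (\<lambda>m. ereal ((\<Sum>i=1..m. x i) / real m)) \<le> ereal (\<alpha> * \<mu>) + ereal \<epsilon>'"
    by (intro Limsup_bounded) (auto elim: eventually_mono)
qed

text \<open>
  The mirror image: here the sum up to \<open>m\<close> is compared with the earlier sum up to \<open>\<alpha>\<^sup>n\<close>.
\<close>

lemma mean_liminf_ge:
  fixes x y :: "nat \<Rightarrow> real"
  assumes \<alpha>: "1 < \<alpha>" and \<nu>: "0 \<le> \<nu>"
    and y: "\<And>i. 1 \<le> i \<Longrightarrow> 0 \<le> y i" and x: "\<And>i. 1 \<le> i \<Longrightarrow> y i \<le> x i"
    and lim: "(\<lambda>n. max 0 (\<Sum>i=1..nat \<lfloor>\<alpha> ^ n\<rfloor>. \<nu> - y i) / \<alpha> ^ n) \<longlonglongrightarrow> 0"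
  shows "ereal (\<nu> / \<alpha>) \<le> liminf (\<lambda>m. ereal ((\<Sum>i=1..m. x i) / real m))"
proof (rule ereal_le_epsilon2)
  fix \<epsilon>' :: real assume "0 < \<epsilon>'"
  define \<epsilon> where "\<epsilon> = \<epsilon>' / 2"
  have \<epsilon>: "0 < \<epsilon>" "\<epsilon>' = 2 * \<epsilon>" using \<open>0 < \<epsilon>'\<close> by (auto simp: \<epsilon>_def)
  obtain N1 where N1: "\<And>n. N1 \<le> n \<Longrightarrow> max 0 (\<Sum>i=1..nat \<lfloor>\<alpha> ^ n\<rfloor>. \<nu> - y i) / \<alpha> ^ n < \<epsilon>"
    using order_tendstoD(2)[OF lim \<epsilon>(1)] unfolding eventually_sequentially by auto
  have bound: "\<nu> / \<alpha> - \<epsilon>' \<le> (\<Sum>i=1..m. x i) / real m"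
    if m: "\<alpha> ^ N1 \<le> real m" "\<nu> / \<epsilon> \<le> real m" "1 \<le> m" for m
  proof -
    obtain n where n: "N1 \<le> n" "\<alpha> ^ n \<le> real m" "real m < \<alpha> ^ Suc n"
      using geometric_bracket[OF \<alpha> m(1)] by blast
    let ?k = "nat \<lfloor>\<alpha> ^ n\<rfloor>"
    have pos: "0 < \<alpha> ^ n" using \<alpha> by simp
    have k: "\<alpha> ^ n - 1 \<le> real ?k" using pos by linarith
    have km: "?k \<le> m" using n(2) by linarith
    have "(\<Sum>i=1..?k. \<nu> - y i) \<le> \<epsilon> * \<alpha> ^ n"
      using N1[of n] n(1) pos by (simp add: field_simps)
    moreover have "(\<alpha> ^ n - 1) * \<nu> \<le> real ?k * \<nu>" using k \<nu> by (rule mult_right_mono)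
    moreover have "(\<Sum>i=1..?k. y i) \<le> (\<Sum>i=1..m. y i)"
      using km y by (intro sum_mono2) auto
    moreover have "(\<Sum>i=1..m. y i) \<le> (\<Sum>i=1..m. x i)"
      using x by (intro sum_mono) auto
    ultimately have 1: "(\<alpha> ^ n - 1) * \<nu> - \<epsilon> * \<alpha> ^ n \<le> (\<Sum>i=1..m. x i)"
      by (simp add: sum_subtractf)
    have "real m / \<alpha> \<le> \<alpha> ^ n" using n(3) \<alpha> by (simp add: field_simps)
    then have "real m / \<alpha> * \<nu> \<le> \<alpha> ^ n * \<nu>" using \<nu> by (rule mult_right_mono)
    moreover have "\<epsilon> * \<alpha> ^ n \<le> \<epsilon> * real m" using n(2) \<epsilon>(1) by simp
    moreover have "\<nu> \<le> \<epsilon> * real m" using m(2) \<epsilon>(1) by (simp add: field_simps)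
    ultimately have "real m / \<alpha> * \<nu> - 2 * \<epsilon> * real m \<le> (\<Sum>i=1..m. x i)"
      using 1 by (simp add: algebra_simps)
    then have "(\<nu> / \<alpha> - \<epsilon>') * real m \<le> (\<Sum>i=1..m. x i)"
      using \<epsilon>(2) by (simp add: algebra_simps)
    then show ?thesis using m(3) by (simp add: pos_le_divide_eq)
  qed
  have "\<forall>\<^sub>F m in sequentially. \<nu> / \<alpha> - \<epsilon>' \<le> (\<Sum>i=1..m. x i) / real m"
    using eventually_conj[OF eventually_conj[OF
        filterlim_at_top[THEN iffD1, OF filterlim_real_sequentially, rule_format, of "\<alpha> ^ N1"]
        filterlim_at_top[THEN iffD1, OF filterlim_real_sequentially, rule_format, of "\<nu> / \<epsilon>"]]
        eventually_ge_at_top[of 1]]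
    by eventually_elim (use bound in auto)
  then have "ereal (\<nu> / \<alpha> - \<epsilon>') \<le> liminf (\<lambda>m. ereal ((\<Sum>i=1..m. x i) / real m))"
    by (intro Liminf_bounded) (auto elim: eventually_mono)
  then have "ereal (\<nu> / \<alpha> - \<epsilon>') + ereal \<epsilon>' \<le> liminf (\<lambda>m. ereal ((\<Sum>i=1..m. x i) / real m)) + ereal \<epsilon>'"
    by (rule add_right_mono)
  then show "ereal (\<nu> / \<alpha>) \<le> liminf (\<lambda>m. ereal ((\<Sum>i=1..m. x i) / real m)) + ereal \<epsilon>'"
    by simp
qed

text \<open>
  The summands are a tail of a geometric series whose first term is at most \<open>t\<close>.
\<close>

lemma geometric_tail_sum:
  fixes r t :: real
  assumes "0 < r" "r < 1" "0 \<le> t"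
  shows "(\<Sum>n<N. if r ^ n \<le> t then r ^ n else 0) \<le> t / (1 - r)"
proof -
  \<comment> \<open>The correction \<open>- r ^ N\<close> makes the bound inductive; the \<open>max\<close> covers the phase before the tail starts.\<close>
  have "(\<Sum>n<N. if r ^ n \<le> t then r ^ n else 0) \<le> max 0 (t - r ^ N) / (1 - r)"
  proof (induction N)
    case 0
    then show ?case using assms by simp
  next
    case (Suc N)
    show ?case
    proof (cases "r ^ N \<le> t")
      case True
      have dec: "r ^ Suc N \<le> r ^ N" using assms by (simp add: mult_left_le_one_le)
      have "(t - r ^ N) / (1 - r) + r ^ N = (t - r ^ Suc N) / (1 - r)"
        using assms by (simp add: field_simps)
      then show ?thesis using Suc True dec by (simp add: max_def)
    next
      case False
      then have "(\<Sum>n<Suc N. if r ^ n \<le> t then r ^ n else 0) \<le> 0" using Suc by (simp add: max_def)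
      also have "0 \<le> max 0 (t - r ^ Suc N) / (1 - r)" using assms by simp
      finally show ?thesis .
    qed
  qed
  also have "\<dots> \<le> t / (1 - r)" using assms by (intro divide_right_mono) auto
  finally show ?thesis .
qed

text \<open>
  After exchanging the sums, \<open>s i\<close> is multiplied by the sum of \<open>\<alpha>\<^sup>-\<^sup>2\<^sup>n\<close> over those \<open>n\<close> with
  \<open>\<alpha>\<^sup>n \<ge> i\<close>, a geometric tail of order \<open>1 / i\<^sup>2\<close>. For second moments \<open>s i\<close> this makes the normalised
  variances of the partial sums summable along the powers of \<open>\<alpha>\<close>, which may fail along
  polynomially growing subsequences.
\<close>

lemma summable_geometric_block_means:
  fixes s :: "nat \<Rightarrow> real"
  assumes \<alpha>: "1 < \<alpha>" and s: "\<And>i. 0 \<le> s i" "summable (\<lambda>i. s i / (real i)\<^sup>2)"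
  shows "summable (\<lambda>n. (\<Sum>i=1..nat \<lfloor>\<alpha> ^ n\<rfloor>. s i) / (\<alpha> ^ n)\<^sup>2)"
proof (rule summableI_nonneg_bounded)
  define r where "r = inverse (\<alpha>\<^sup>2)"
  have r: "0 < r" "r < 1" using \<alpha> by (auto simp: r_def inverse_less_1_iff one_less_power)
  have rn: "1 / (\<alpha> ^ n)\<^sup>2 = r ^ n" for n
    unfolding r_def by (simp add: power_inverse power_mult[symmetric] mult.commute divide_inverse)
  show "0 \<le> (\<Sum>i=1..nat \<lfloor>\<alpha> ^ n\<rfloor>. s i) / (\<alpha> ^ n)\<^sup>2" for n
    using s by (intro divide_nonneg_nonneg sum_nonneg) auto
  fix N
  define J where "J = nat \<lfloor>\<alpha> ^ N\<rfloor>"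
  have le: "(\<Sum>i=1..nat \<lfloor>\<alpha> ^ n\<rfloor>. s i) / (\<alpha> ^ n)\<^sup>2
      \<le> (\<Sum>i=1..J. s i * (if r ^ n \<le> 1 / (real i)\<^sup>2 then r ^ n else 0))" if "n < N" for n
  proof -
    have "\<alpha> ^ n \<le> \<alpha> ^ N" using that \<alpha> by (intro power_increasing) auto
    then have sub: "{1..nat \<lfloor>\<alpha> ^ n\<rfloor>} \<subseteq> {1..J}" 
      unfolding J_def by (intro atLeastatMost_subset_iff[THEN iffD2] disjI2 conjI nat_mono floor_mono order_refl)
    have ind: "r ^ n \<le> 1 / (real i)\<^sup>2" if "i \<in> {1..nat \<lfloor>\<alpha> ^ n\<rfloor>}" for i
    proof -
      have "real i \<le> \<alpha> ^ n" using that \<alpha> by (simp add: le_nat_iff le_floor_iff)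
      then have "(real i)\<^sup>2 \<le> (\<alpha> ^ n)\<^sup>2" by (intro power_mono) auto
      then show ?thesis unfolding rn[symmetric] using that \<alpha> by (intro divide_left_mono mult_pos_pos zero_less_power) auto
    qed
    have "(\<Sum>i=1..nat \<lfloor>\<alpha> ^ n\<rfloor>. s i) / (\<alpha> ^ n)\<^sup>2 = (\<Sum>i=1..nat \<lfloor>\<alpha> ^ n\<rfloor>. s i) * (1 / (\<alpha> ^ n)\<^sup>2)"
      by simp
    also have "\<dots> = (\<Sum>i=1..nat \<lfloor>\<alpha> ^ n\<rfloor>. s i * r ^ n)"
      unfolding rn by (simp add: sum_distrib_right)
    also have "\<dots> = (\<Sum>i=1..nat \<lfloor>\<alpha> ^ n\<rfloor>. s i * (if r ^ n \<le> 1 / (real i)\<^sup>2 then r ^ n else 0))"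
      using ind by (intro sum.cong) auto
    also have "\<dots> \<le> (\<Sum>i=1..J. s i * (if r ^ n \<le> 1 / (real i)\<^sup>2 then r ^ n else 0))"
      using sub s r by (intro sum_mono2) auto
    finally show ?thesis .
  qed
  have "(\<Sum>n<N. (\<Sum>i=1..nat \<lfloor>\<alpha> ^ n\<rfloor>. s i) / (\<alpha> ^ n)\<^sup>2)
      \<le> (\<Sum>n<N. \<Sum>i=1..J. s i * (if r ^ n \<le> 1 / (real i)\<^sup>2 then r ^ n else 0))"
    using le by (intro sum_mono) auto
  also have "\<dots> = (\<Sum>i=1..J. s i * (\<Sum>n<N. if r ^ n \<le> 1 / (real i)\<^sup>2 then r ^ n else 0))"
    by (subst sum.swap) (simp add: sum_distrib_left)
  also have "\<dots> \<le> (\<Sum>i=1..J. s i * ((1 / (real i)\<^sup>2) / (1 - r)))"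
    using s r by (intro sum_mono mult_left_mono geometric_tail_sum) auto
  also have "\<dots> = (\<Sum>i=1..J. s i / (real i)\<^sup>2) / (1 - r)"
    by (simp add: sum_divide_distrib)
  also have "\<dots> \<le> (\<Sum>i. s i / (real i)\<^sup>2) / (1 - r)"
    using s r by (intro divide_right_mono sum_le_suminf) auto
  finally show "(\<Sum>n<N. (\<Sum>i=1..nat \<lfloor>\<alpha> ^ n\<rfloor>. s i) / (\<alpha> ^ n)\<^sup>2) \<le> (\<Sum>i. s i / (real i)\<^sup>2) / (1 - r)" .
qed

section \<open>Truncated second moments and the blocks \<open>(k, k + 1]\<close>\<close>

text \<open>
  An upper bound for \<open>(min x i)\<^sup>2 / x\<close> on the block \<open>k < x \<le> k + 1\<close>. If \<open>k \<ge> i\<close> and \<open>k = 0\<close> then \<open>i = 0\<close>, and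
  the value \<open>0\<close> of the quotient is the right one.
\<close>

definition sq_weight :: "nat \<Rightarrow> nat \<Rightarrow> real" where
  "sq_weight k i = (if k < i then real k + 1 else (real i)\<^sup>2 / real k)"

lemma trunc_sq_le_sq_weight:
  assumes "real k < x" "x \<le> real k + 1"
  shows "(trunc (real i) x)\<^sup>2 \<le> sq_weight k i * x"
proof (cases "k < i")
  case True
  then have "trunc (real i) x = x" using assms by (auto simp: trunc_def)
  then show ?thesis using assms True by (simp add: sq_weight_def power2_eq_square mult_right_mono)
next
  case False
  then have t: "trunc (real i) x = real i" using assms by (auto simp: trunc_def)
  show ?thesis
  proof (cases "k = 0")
    case True
    then show ?thesis using False by (auto simp: sq_weight_def trunc_def max_def min_def)
  next
    case k: False
    then have "(real i)\<^sup>2 * 1 \<le> (real i)\<^sup>2 * (x / real k)"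
      using assms by (intro mult_left_mono) auto
    then show ?thesis unfolding t using False by (simp add: sq_weight_def)
  qed
qed

text \<open>
  The indices \<open>i \<le> k\<close> contribute at most \<open>1 / k\<close> each, hence at most \<open>1\<close> together; the indices \<open>i > k\<close>
  contribute \<open>(k + 1) / i\<^sup>2\<close>, and the sum of \<open>1 / i\<^sup>2\<close> from \<open>k + 1\<close> on is at most \<open>2 / (k + 1)\<close>.
\<close>

lemma sq_weight_sum_le: "(\<Sum>i<N. sq_weight k i / (real i)\<^sup>2) \<le> 3"
proof -
  let ?S = "\<lambda>N. \<Sum>i<Suc N. sq_weight k i / (real i)\<^sup>2"
  \<comment> \<open>Beyond \<open>k\<close>, the bound telescopes through \<open>1 / (N + 1)\<^sup>2 \<le> 1 / N - 1 / (N + 1)\<close>.\<close>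
  have "?S N \<le> (if N \<le> k then real N / real k else 3 - (real k + 1) / real N)" for N
  proof (induction N)
    case 0
    then show ?case by (simp add: sq_weight_def)
  next
    case (Suc N)
    consider "Suc N \<le> k" | "N = k" | "k < N" by linarith
    then show ?case
    proof cases
      case 1
      then have "sq_weight k (Suc N) / (real (Suc N))\<^sup>2 = 1 / real k"
        by (simp add: sq_weight_def del: of_nat_Suc)
      then have "?S (Suc N) \<le> real N / real k + 1 / real k" using Suc 1 by simp
      also have "\<dots> = real (Suc N) / real k" by (simp add: add_divide_distrib)
      finally show ?thesis using 1 by simp
    next
      case 2
      have "sq_weight k (Suc k) / (real (Suc k))\<^sup>2 = 1 / (real k + 1)"
        by (simp add: sq_weight_def power2_eq_square add.commute)
      moreover have "1 / (real k + 1) \<le> 1" by simp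
      moreover have "?S k \<le> 1"
        using Suc 2 by (auto intro: order_trans split: if_splits)
      ultimately have "?S (Suc k) \<le> 2" unfolding sum.lessThan_Suc[of _ "Suc k"] by linarith
      also have "2 = 3 - (real k + 1) / real (Suc k)" by simp
      finally show ?thesis using 2 by simp
    next
      case 3
      have N: "0 < real N" using 3 by simp
      have "sq_weight k (Suc N) / (real (Suc N))\<^sup>2 = (real k + 1) * (1 / (real N + 1)\<^sup>2)"
        using 3 by (simp add: sq_weight_def add.commute)
      also have "\<dots> \<le> (real k + 1) * (1 / real N - 1 / (real N + 1))"
        using N by (intro mult_left_mono) (auto simp: diff_frac_eq power2_eq_square intro!: divide_left_mono)
      finally have "?S (Suc N) \<le> 3 - (real k + 1) / real N + (real k + 1) * (1 / real N - 1 / (real N + 1))"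
        using Suc 3 by simp
      also have "\<dots> = 3 - (real k + 1) / real (Suc N)" by (simp add: right_diff_distrib add.commute)
      finally show ?thesis using 3 by simp
    qed
  qed
  moreover have "(if N \<le> k then real N / real k else 3 - (real k + 1) / real N) \<le> 3" for N
    by (auto simp: divide_le_eq)
  ultimately have "?S N \<le> 3" for N by (meson order_trans)
  then show ?thesis
    by (cases N) simp_all
qed

lemma sq_weight_nonneg: "0 \<le> sq_weight k i"
  by (simp add: sq_weight_def)

lemma sq_weight_le: "sq_weight k i \<le> real i"
proof (cases "k < i")
  case False
  then have "(real i)\<^sup>2 \<le> real i * real k" unfolding power2_eq_square by (intro mult_left_mono) auto
  then show ?thesis using False by (cases "k = 0") (auto simp: sq_weight_def divide_le_eq)
qed (simp add: sq_weight_def)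

text \<open>
  If \<open>b k\<close> bounds the integrals of \<open>X\<close> over \<open>k < X \<le> k + 1\<close> under all measures of the family, then
  the inner sum bounds the upper expectation of \<open>(min X i)\<^sup>2\<close>. Taking the supremum within each block
  is what makes the bounds summable after the exchange of the two sums: the suprema over the family
  are inside.
\<close>

lemma summable_sq_weight_averages:
  fixes b :: "nat \<Rightarrow> real"
  assumes b: "\<And>k. 0 \<le> b k" "summable b"
  shows "summable (\<lambda>k. sq_weight k i * b k)"
    and "summable (\<lambda>i. (\<Sum>k. sq_weight k i * b k) / (real i)\<^sup>2)"
proof -
  have sm: "summable (\<lambda>k. sq_weight k i * b k)" for i
  proof (rule summable_comparison_test'[OF summable_mult[OF b(2), of "real i"], of 0])
    show "norm (sq_weight k i * b k) \<le> real i * b k" for k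
      using b(1)[of k] sq_weight_nonneg[of k i] sq_weight_le[of k i]
      by (simp add: abs_mult mult_right_mono)
  qed
  then show "summable (\<lambda>k. sq_weight k i * b k)" .
  show "summable (\<lambda>i. (\<Sum>k. sq_weight k i * b k) / (real i)\<^sup>2)"
  proof (rule summableI_nonneg_bounded)
    show "0 \<le> (\<Sum>k. sq_weight k i * b k) / (real i)\<^sup>2" for i
      using b sq_weight_nonneg sm by (intro divide_nonneg_nonneg suminf_nonneg mult_nonneg_nonneg zero_le_power2)
    fix N
    have sm': "summable (\<lambda>k. sq_weight k i * b k / (real i)\<^sup>2)" for i
      using sm by (rule summable_divide)
    have "(\<Sum>i<N. (\<Sum>k. sq_weight k i * b k) / (real i)\<^sup>2)
        = (\<Sum>i<N. \<Sum>k. sq_weight k i * b k / (real i)\<^sup>2)"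
      by (intro sum.cong refl suminf_divide[symmetric] sm)
    also have "\<dots> = (\<Sum>k. \<Sum>i<N. sq_weight k i * b k / (real i)\<^sup>2)"
      by (rule suminf_sum[symmetric]) (rule sm')
    also have "\<dots> \<le> (\<Sum>k. 3 * b k)"
    proof (rule suminf_le)
      fix k
      have "(\<Sum>i<N. sq_weight k i * b k / (real i)\<^sup>2) = (\<Sum>i<N. sq_weight k i / (real i)\<^sup>2) * b k"
        by (simp add: sum_distrib_right)
      also have "\<dots> \<le> 3 * b k" using sq_weight_sum_le b by (intro mult_right_mono) auto
      finally show "(\<Sum>i<N. sq_weight k i * b k / (real i)\<^sup>2) \<le> 3 * b k" .
    qed (intro summable_sum sm' summable_mult b(2))+
    finally show "(\<Sum>i<N. (\<Sum>k. sq_weight k i * b k) / (real i)\<^sup>2) \<le> (\<Sum>k. 3 * b k)" .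
  qed
qed

section \<open>Sublinear expectations and representing measures\<close>

context sublinear_expectation_space
begin

lemma lipschitz_comp_in_H:
  assumes "Y \<in> H" "0 \<le> K" "\<And>a b. \<bar>g a - g b\<bar> \<le> K * \<bar>a - b\<bar>"
  shows "(\<lambda>\<omega>. g (Y \<omega>)) \<in> H"
proof -
  have "l2_dist 1 x y = \<bar>x ! 0 - y ! 0\<bar>" for x y
    by (simp add: L2_set_def)
  then have "(\<lambda>x. g (x ! 0)) \<in> C_lLip 1"
    using assms(2,3) by (intro lipschitz_in_C_lLip[of K]) auto
  then have "(\<lambda>\<omega>. g (rvec [Y] \<omega> ! 0)) \<in> H"
    using assms(1) by (intro C_lLip_in_H[of "[Y]" "\<lambda>x. g (x ! 0)"]) auto
  then show ?thesis by (simp add: rvec_def)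
qed

lemma const_in_H: "(\<lambda>\<omega>. c) \<in> H"
  using lipschitz_comp_in_H[of "indicator {}" 0 "\<lambda>_. c"] indicator_in_H[of "{}"] by simp

lemma E_nonneg:
  assumes "F \<in> H" "\<And>\<omega>. \<omega> \<in> space M \<Longrightarrow> 0 \<le> F \<omega>"
  shows "0 \<le> E F"
  using E_mono[OF assms(1) const_in_H[of 0]] assms(2) E_const[of 0] by (simp add: zero_ereal_def)

lemma E_le_const:
  assumes "F \<in> H" "\<And>\<omega>. \<omega> \<in> space M \<Longrightarrow> F \<omega> \<le> c"
  shows "E F \<le> ereal c"
  using E_mono[OF const_in_H[of c] assms(1)] assms(2) E_const[of c] by simp

lemma E_finite_if_bounded:
  assumes "F \<in> H" "\<And>\<omega>. \<omega> \<in> space M \<Longrightarrow> \<bar>F \<omega>\<bar> \<le> K"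
  shows "\<bar>E F\<bar> \<noteq> \<infinity>"
proof -
  have "E F \<le> ereal K" using assms by (intro E_le_const) (auto dest: abs_le_D1)
  moreover have "ereal (- K) \<le> E F"
    using E_mono[OF assms(1) const_in_H[of "- K"]] assms(2) E_const[of "- K"] by (fastforce dest: abs_le_D2)
  ultimately show ?thesis by (cases "E F") auto
qed

lemma E_add_const:
  assumes "F \<in> H" "\<bar>E F\<bar> \<noteq> \<infinity>"
  shows "E (\<lambda>\<omega>. F \<omega> + c) = E F + ereal c"
proof (rule antisym)
  have Fc: "(\<lambda>\<omega>. F \<omega> + c) \<in> H"
    using assms(1) by (rule lipschitz_comp_in_H[where K = 1 and g = "\<lambda>x. x + c"]) auto
  show "E (\<lambda>\<omega>. F \<omega> + c) \<le> E F + ereal c"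
    using E_subadd[OF assms(1) const_in_H[of c]] assms(2) E_const by auto
  have "E (\<lambda>\<omega>. (F \<omega> + c) + (- c)) \<le> E (\<lambda>\<omega>. F \<omega> + c) + ereal (- c)"
    using E_subadd[OF Fc const_in_H[of "- c"]] E_const[of "- c"] by auto
  then show "E F + ereal c \<le> E (\<lambda>\<omega>. F \<omega> + c)"
    using assms(2) by (cases "E F"; cases "E (\<lambda>\<omega>. F \<omega> + c)") auto
qed

end

text \<open>
  In the application \<open>b k\<close> is the supremum over \<open>Q\<close> of the integral of \<open>x\<close> over \<open>(k, k + 1]\<close> with
  respect to the distribution function of \<open>X 1\<close>. Having real numbers here, and integrals under \<open>Q\<close>,
  keeps extended reals and Lebesgue--Stieltjes measures out of the estimates.
\<close>

locale iid_sequence = sublinear_expectation_space M H E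
  for M :: "'a measure" and H and E +
  fixes P :: "'a measure set" and X :: "nat \<Rightarrow> 'a \<Rightarrow> real" and b :: "nat \<Rightarrow> real"
  assumes rep: "represents M H E P"
    and X_in_H: "1 \<le> n \<Longrightarrow> X n \<in> H"
    and X_nonneg: "1 \<le> n \<Longrightarrow> \<omega> \<in> space M \<Longrightarrow> 0 \<le> X n \<omega>"
    and indep: "independent_seq H E X"
    and ident: "1 \<le> i \<Longrightarrow> 1 \<le> j \<Longrightarrow> identically_distributed E [X i] E [X j]"
    and block_bound: "Q \<in> P \<Longrightarrow>
      (\<integral>\<^sup>+\<omega>. ennreal (X 1 \<omega>) * indicator {real k<..real (k + 1)} (X 1 \<omega>) \<partial>Q) \<le> ennreal (b k)"
    and b_nonneg: "0 \<le> b k"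
    and b_summable: "summable b"
begin

lemma P_sets: "Q \<in> P \<Longrightarrow> sets Q = sets M"
  using rep by (simp add: represents_def)

lemma P_space: "Q \<in> P \<Longrightarrow> space Q = space M"
  using sets_eq_imp_space_eq[OF P_sets] .

lemma P_measurable: "F \<in> H \<Longrightarrow> Q \<in> P \<Longrightarrow> F \<in> borel_measurable Q"
  using random_variables measurable_cong_sets[OF P_sets refl] by blast

text \<open>
  For a non-negative variable all expectations exist, so the representation applies without further
  conditions. The next two lemmas transfer bounds between \<open>E\<close> and the individual measures.
\<close>

lemma E_nonneg_eq:
  assumes "F \<in> H" "\<And>\<omega>. \<omega> \<in> space M \<Longrightarrow> 0 \<le> F \<omega>"
  shows "E F = (SUP Q\<in>P. enn2ereal (\<integral>\<^sup>+\<omega>. ennreal (F \<omega>) \<partial>Q))"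
proof -
  have 0: "(\<integral>\<^sup>+\<omega>. ennreal (- F \<omega>) \<partial>Q) = 0" if "Q \<in> P" for Q
  proof -
    have "(\<integral>\<^sup>+\<omega>. ennreal (- F \<omega>) \<partial>Q) = (\<integral>\<^sup>+\<omega>. 0 \<partial>Q)"
      using assms(2) P_space[OF that] by (intro nn_integral_cong) (simp add: ennreal_neg)
    then show ?thesis by simp
  qed
  have "\<forall>Q\<in>P. expect_exists Q F" using 0 by (simp add: expect_exists_def)
  then have "E F = (SUP Q\<in>P. expect Q F)"
    using rep assms(1) unfolding represents_def by blast
  also have "\<dots> = (SUP Q\<in>P. enn2ereal (\<integral>\<^sup>+\<omega>. ennreal (F \<omega>) \<partial>Q))"
    using 0 by (intro SUP_cong) (simp_all add: expect_def zero_ennreal.rep_eq)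
  finally show ?thesis .
qed

lemma nn_integral_le_if_E_le:
  assumes "F \<in> H" "\<And>\<omega>. \<omega> \<in> space M \<Longrightarrow> 0 \<le> F \<omega>" "Q \<in> P" "E F \<le> ereal c"
  shows "(\<integral>\<^sup>+\<omega>. ennreal (F \<omega>) \<partial>Q) \<le> ennreal c"
proof -
  have "enn2ereal (\<integral>\<^sup>+\<omega>. ennreal (F \<omega>) \<partial>Q) \<le> E F"
    using SUP_upper[OF assms(3), of "\<lambda>Q. enn2ereal (\<integral>\<^sup>+\<omega>. ennreal (F \<omega>) \<partial>Q)"] E_nonneg_eq[OF assms(1,2)]
    by simp
  then have "enn2ereal (\<integral>\<^sup>+\<omega>. ennreal (F \<omega>) \<partial>Q) \<le> ereal c" using assms(4) by (rule order_trans)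
  then show ?thesis using e2ennreal_mono by fastforce
qed

lemma E_le_if_nn_integral_le:
  assumes "F \<in> H" "\<And>\<omega>. \<omega> \<in> space M \<Longrightarrow> 0 \<le> F \<omega>" "0 \<le> c"
    and "\<And>Q. Q \<in> P \<Longrightarrow> (\<integral>\<^sup>+\<omega>. ennreal (F \<omega>) \<partial>Q) \<le> ennreal c"
  shows "E F \<le> ereal c"
proof -
  have "enn2ereal (\<integral>\<^sup>+\<omega>. ennreal (F \<omega>) \<partial>Q) \<le> enn2ereal (ennreal c)" if "Q \<in> P" for Q
    using assms(4)[OF that] by (simp add: less_eq_ennreal.rep_eq)
  then have "(SUP Q\<in>P. enn2ereal (\<integral>\<^sup>+\<omega>. ennreal (F \<omega>) \<partial>Q)) \<le> ereal c"
    using assms(3) by (intro SUP_least) simp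
  then show ?thesis using E_nonneg_eq[OF assms(1,2)] by simp
qed

lemma comp_in_H: "g \<in> bdd_lip_real \<Longrightarrow> 1 \<le> i \<Longrightarrow> (\<lambda>\<omega>. g (X i \<omega>)) \<in> H"
  unfolding bdd_lip_def using X_in_H by (auto simp: dist_real_def intro: lipschitz_comp_in_H)

lemma E_comp_finite: 
  assumes "g \<in> bdd_lip_real" "1 \<le> i" 
  shows "\<bar>E (\<lambda>\<omega>. g (X i \<omega>))\<bar> \<noteq> \<infinity>"
proof -
  obtain K where "\<And>x. \<bar>g x\<bar> \<le> K" using assms(1) unfolding bdd_lip_def by auto
  then show ?thesis using comp_in_H[OF assms] by (intro E_finite_if_bounded) auto
qed

lemma E_comp_eq:
  assumes "g \<in> bdd_lip_real" "1 \<le> i"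
  shows "E (\<lambda>\<omega>. g (X i \<omega>)) = E (\<lambda>\<omega>. g (X 1 \<omega>))"
proof -
  have "(\<lambda>x. g (x ! 0)) \<in> C_lLip 1"
    using assms(1) by (intro bdd_lip_vec_in_C_lLip bdd_lip_vec_coordinate) auto
  then show ?thesis
    using ident[OF assms(2) order_refl] E_comp_finite[OF assms] E_comp_finite[OF assms(1) order_refl]
    unfolding identically_distributed_def by (elim conjE) (drule bspec, auto simp: rvec_def)
qed

section \<open>A one-sided Kolmogorov estimate\<close>

definition bdd_lip_past :: "nat \<Rightarrow> ('a \<Rightarrow> real) set" where
  "bdd_lip_past n = {\<lambda>\<omega>. \<phi> (rvec (map X [1..<Suc n]) \<omega>) | \<phi>. \<phi> \<in> bdd_lip_vec n}"

lemma bdd_lip_pastI: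
  "\<phi> \<in> bdd_lip_vec n \<Longrightarrow> F = (\<lambda>\<omega>. \<phi> (rvec (map X [1..<Suc n]) \<omega>)) \<Longrightarrow> F \<in> bdd_lip_past n"
  by (auto simp: bdd_lip_past_def)

lemma bdd_lip_pastE:
  assumes "F \<in> bdd_lip_past n"
  obtains \<phi> where "\<phi> \<in> bdd_lip_vec n" "F = (\<lambda>\<omega>. \<phi> (rvec (map X [1..<Suc n]) \<omega>))"
  using assms by (auto simp: bdd_lip_past_def)

lemma bdd_lip_past_add:
  "F \<in> bdd_lip_past n \<Longrightarrow> G \<in> bdd_lip_past n \<Longrightarrow> (\<lambda>\<omega>. F \<omega> + G \<omega>) \<in> bdd_lip_past n"
  by (elim bdd_lip_pastE) (rule bdd_lip_pastI[OF bdd_lip_add], auto)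

lemma bdd_lip_past_mult:
  "F \<in> bdd_lip_past n \<Longrightarrow> G \<in> bdd_lip_past n \<Longrightarrow> (\<lambda>\<omega>. F \<omega> * G \<omega>) \<in> bdd_lip_past n"
  by (elim bdd_lip_pastE) (rule bdd_lip_pastI[OF bdd_lip_mult], auto)

lemma bdd_lip_past_const: "(\<lambda>\<omega>. c) \<in> bdd_lip_past n"
  by (rule bdd_lip_pastI[OF bdd_lip_const]) (auto simp: L2_set_nonneg)

lemma bdd_lip_past_pos:
  "F \<in> bdd_lip_past n \<Longrightarrow> (\<lambda>\<omega>. max 0 (F \<omega>)) \<in> bdd_lip_past n"
  by (elim bdd_lip_pastE) (rule bdd_lip_pastI[OF bdd_lip_contraction[where h = "max 0"]], auto)

lemma bdd_lip_past_component:
  assumes "g \<in> bdd_lip_real" "1 \<le> i" "i \<le> n"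
  shows "(\<lambda>\<omega>. g (X i \<omega>)) \<in> bdd_lip_past n"
proof (rule bdd_lip_pastI)
  show "(\<lambda>x. g (x ! (i - 1))) \<in> bdd_lip_vec n"
    using assms by (intro bdd_lip_vec_coordinate) auto
  show "(\<lambda>\<omega>. g (X i \<omega>)) = (\<lambda>\<omega>. g (rvec (map X [1..<Suc n]) \<omega> ! (i - 1)))"
    using assms by (simp add: rvec_def del: upt_Suc)
qed

lemma bdd_lip_past_sum:
  assumes "\<And>i. i \<in> A \<Longrightarrow> F i \<in> bdd_lip_past n"
  shows "(\<lambda>\<omega>. \<Sum>i\<in>A. F i \<omega>) \<in> bdd_lip_past n"
  using assms
  by (induction A rule: infinite_finite_induct) (auto intro: bdd_lip_past_add bdd_lip_past_const)

lemma bdd_lip_past_in_H: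
  assumes "F \<in> bdd_lip_past n" "1 \<le> n"
  shows "F \<in> H"
proof -
  obtain \<phi> where \<phi>: "\<phi> \<in> bdd_lip_vec n" "F = (\<lambda>\<omega>. \<phi> (rvec (map X [1..<Suc n]) \<omega>))"
    using assms(1) by (rule bdd_lip_pastE)
  have "set (map X [1..<Suc n]) \<subseteq> H" using X_in_H by (auto simp del: upt_Suc)
  then show ?thesis
    unfolding \<phi>(2) using assms(2) bdd_lip_vec_in_C_lLip[OF \<phi>(1)]
    by (intro C_lLip_in_H) (auto simp del: upt_Suc)
qed

lemma bdd_lip_past_bounded:
  assumes "F \<in> bdd_lip_past n"
  obtains K where "\<And>\<omega>. \<bar>F \<omega>\<bar> \<le> K"
proof -
  obtain \<phi> where \<phi>: "\<phi> \<in> bdd_lip_vec n" "F = (\<lambda>\<omega>. \<phi> (rvec (map X [1..<Suc n]) \<omega>))"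
    using assms(1) by (rule bdd_lip_pastE)
  obtain K where "\<And>x. length x = n \<Longrightarrow> \<bar>\<phi> x\<bar> \<le> K" using \<phi>(1) unfolding bdd_lip_def by auto
  then have "\<bar>F \<omega>\<bar> \<le> K" for \<omega> unfolding \<phi>(2) by (simp add: rvec_def)
  then show thesis by (rule that)
qed

lemma bdd_lip_past_E_finite:
  assumes "F \<in> bdd_lip_past n" "1 \<le> n"
  shows "\<bar>E F\<bar> \<noteq> \<infinity>"
proof -
  obtain K where "\<And>\<omega>. \<bar>F \<omega>\<bar> \<le> K" using bdd_lip_past_bounded[OF assms(1)] by blast
  then show ?thesis using bdd_lip_past_in_H[OF assms] by (intro E_finite_if_bounded) auto
qed

lemma bdd_lip_past_subadd:
  assumes "F \<in> bdd_lip_past n" "G \<in> bdd_lip_past n" "1 \<le> n"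
  shows "E (\<lambda>\<omega>. F \<omega> + G \<omega>) \<le> E F + E G"
  using E_subadd[OF bdd_lip_past_in_H bdd_lip_past_in_H, OF assms(1,3,2,3)]
    bdd_lip_past_E_finite[OF assms(1,3)] by auto

text \<open>
  The weak sense in which centred variables are orthogonal to the past. For
  \<open>\<Phi>(x, y) = (f x)\<^sup>+ g y\<close> the partial expectation is explicit: by positive homogeneity,
  \<open>E (\<Phi>(x, Y)) = (f x)\<^sup>+ E (g Y) = 0\<close>. So it is trivially in the domain of \<open>E\<close>, as independence
  demands, and no regularity of a general partial expectation has to be established. Positivity of the
  first factor is essential, because \<open>E (- g Y)\<close> may be strictly positive.
\<close>

lemma E_pos_part_mult_centred:
  assumes F: "F \<in> bdd_lip_past n" and g: "g \<in> bdd_lip_real" and n: "1 \<le> n"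
    and E0: "E (\<lambda>\<omega>. g (X (Suc n) \<omega>)) = 0"
  shows "E (\<lambda>\<omega>. max 0 (F \<omega>) * g (X (Suc n) \<omega>)) = 0"
proof -
  let ?Xs = "map X [1..<Suc n]" and ?Y = "X (Suc n)"
  obtain \<phi> where \<phi>: "\<phi> \<in> bdd_lip_vec n" "F = (\<lambda>\<omega>. \<phi> (rvec ?Xs \<omega>))"
    using F by (rule bdd_lip_pastE)
  define p where "p x = max 0 (\<phi> x)" for x
  have p0: "0 \<le> p x" for x by (simp add: p_def)
  have p: "p \<in> bdd_lip_vec n"
    unfolding p_def[abs_def] by (rule bdd_lip_contraction[OF \<phi>(1)]) auto
  have len: "length ?Xs = n" by simp
  define \<Phi> where "\<Phi> x = p (take n x) * g (x ! n)" for x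
  have \<Phi>: "\<Phi> \<in> C_lLip (length ?Xs + length [?Y])"
  proof -
    have "(\<lambda>x. p (take n x)) \<in> bdd_lip_vec (Suc n)"
    proof -
      obtain K where K: "0 \<le> K" "\<And>x y. length x = n \<Longrightarrow> length y = n \<Longrightarrow>
          \<bar>p x\<bar> \<le> K \<and> \<bar>p x - p y\<bar> \<le> K * l2_dist n x y"
        using p unfolding bdd_lip_def by auto
      have "l2_dist n (take n x) (take n y) \<le> l2_dist (Suc n) x y" for x y
      proof -
        have "l2_dist n (take n x) (take n y) = l2_dist n x y"
          by (intro L2_set_cong) auto
        also have "\<dots> \<le> l2_dist (Suc n) x y"
          unfolding L2_set_def by (intro real_sqrt_le_mono sum_mono2) auto
        finally show ?thesis .
      qed
      then have "K * l2_dist n (take n x) (take n y) \<le> K * l2_dist (Suc n) x y" for x y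
        using K(1) by (intro mult_left_mono) 
      moreover have "\<bar>p (take n x)\<bar> \<le> K \<and>
          \<bar>p (take n x) - p (take n y)\<bar> \<le> K * l2_dist n (take n x) (take n y)"
        if "length x = Suc n" "length y = Suc n" for x y
        using that by (intro K(2)) auto
      ultimately have "\<bar>p (take n x)\<bar> \<le> K \<and> \<bar>p (take n x) - p (take n y)\<bar> \<le> K * l2_dist (Suc n) x y"
        if "length x = Suc n" "length y = Suc n" for x y
        using that by (meson order_trans)
      then show ?thesis unfolding bdd_lip_def using K(1) by blast
    qed
    then have "\<Phi> \<in> bdd_lip_vec (Suc n)"
      unfolding \<Phi>_def[abs_def] using g by (intro bdd_lip_mult bdd_lip_vec_coordinate) auto
    then show ?thesis using bdd_lip_vec_in_C_lLip[of \<Phi> "Suc n"] n by (simp add: Suc_diff_le)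
  qed
  have app: "\<Phi> (x @ rvec [?Y] \<omega>) = p x * g (?Y \<omega>)" if "length x = n" for x \<omega>
    using that by (simp add: \<Phi>_def rvec_def nth_append)
  have Y_in: "(\<lambda>\<omega>. g (?Y \<omega>)) \<in> H" using g by (intro comp_in_H) auto
  have gabs: "(\<lambda>x. \<bar>g x\<bar>) \<in> bdd_lip_real" by (rule bdd_lip_contraction[OF g]) auto
  have Yabs_in: "(\<lambda>\<omega>. \<bar>g (?Y \<omega>)\<bar>) \<in> H" using gabs by (rule comp_in_H) auto
  define c where "c = real_of_ereal (E (\<lambda>\<omega>. \<bar>g (?Y \<omega>)\<bar>))"
  have c: "E (\<lambda>\<omega>. \<bar>g (?Y \<omega>)\<bar>) = ereal c"
    unfolding c_def using E_comp_finite[OF gabs, of "Suc n"] by (simp add: ereal_real)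
  have outer: "E (\<lambda>\<omega>. \<bar>\<Phi> (x @ rvec [?Y] \<omega>)\<bar>) = ereal (p x * c)" if "length x = n" for x
    using E_scale[OF Yabs_in p0[of x]] that by (simp add: app abs_mult p0 c)
  have inner: "E (\<lambda>\<omega>. \<Phi> (x @ rvec [?Y] \<omega>)) = 0" if "length x = n" for x
    using E_scale[OF Y_in p0[of x]] that by (simp add: app E0)
  have lenr: "length (rvec ?Xs \<omega>) = n" for \<omega> by (simp add: rvec_def)
  have Z: "(\<lambda>\<omega>. \<bar>real_of_ereal (E (\<lambda>\<omega>'. \<bar>\<Phi> (rvec ?Xs \<omega> @ rvec [?Y] \<omega>')\<bar>))\<bar>) \<in> bdd_lip_past n"
    unfolding outer[OF lenr] real_of_ereal.simps
    by (rule bdd_lip_pastI[OF bdd_lip_contraction[OF bdd_lip_mult[OF p bdd_lip_const], where h = abs]])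
       (auto simp: L2_set_nonneg)
  have W: "(\<lambda>\<omega>. real_of_ereal (E (\<lambda>\<omega>'. \<Phi> (rvec ?Xs \<omega> @ rvec [?Y] \<omega>')))) = (\<lambda>\<omega>. 0)"
    unfolding inner[OF lenr] by simp
  have "indep_of H E [?Y] ?Xs" using indep n by (simp add: independent_seq_def del: upt_Suc)
  note indep_n = this[unfolded indep_of_def Let_def, rule_format, OF \<Phi>]
  have "E (\<lambda>\<omega>. \<Phi> (rvec ?Xs \<omega> @ rvec [?Y] \<omega>)) = E (\<lambda>\<omega>. 0)"
    unfolding W[symmetric]
  proof (rule indep_n)
    show "E (\<lambda>\<omega>. \<bar>\<Phi> (x @ rvec [?Y] \<omega>)\<bar>) < \<infinity>" if "length x = length ?Xs" for x
      using outer that len by simp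
    show "(\<lambda>\<omega>. \<bar>real_of_ereal (E (\<lambda>\<omega>'. \<bar>\<Phi> (rvec ?Xs \<omega> @ rvec [?Y] \<omega>')\<bar>))\<bar>) \<in> H"
      by (rule bdd_lip_past_in_H[OF Z n])
    show "E (\<lambda>\<omega>. \<bar>real_of_ereal (E (\<lambda>\<omega>'. \<bar>\<Phi> (rvec ?Xs \<omega> @ rvec [?Y] \<omega>')\<bar>))\<bar>) < \<infinity>"
      using bdd_lip_past_E_finite[OF Z n] less_top[unfolded top_ereal_def] by fastforce
    show "(\<lambda>\<omega>. real_of_ereal (E (\<lambda>\<omega>'. \<Phi> (rvec ?Xs \<omega> @ rvec [?Y] \<omega>')))) \<in> H"
      unfolding W by (rule const_in_H)
  qed
  then show ?thesis
    unfolding app[OF lenr] using E_const[of 0] \<phi>(2) by (simp add: p_def zero_ereal_def)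
qed

text \<open>
  The variance of the sum of the \<open>G i (X i)\<close> is not controlled by the sum of the variances, since only
  the upper expectations vanish. Its positive part is controlled, because
  \<open>((S + g)\<^sup>+)\<^sup>2 \<le> (S\<^sup>+)\<^sup>2 + 2 S\<^sup>+ g + g\<^sup>2\<close> and the mixed term, whose factor \<open>S\<^sup>+\<close> is non-negative, has
  upper expectation \<open>0\<close>.
\<close>

lemma E_pos_part_sum_sq_le:
  assumes G: "\<And>i. 1 \<le> i \<Longrightarrow> G i \<in> bdd_lip_real"
    and E0: "\<And>i. 1 \<le> i \<Longrightarrow> E (\<lambda>\<omega>. G i (X i \<omega>)) = 0"
    and V: "\<And>i. 1 \<le> i \<Longrightarrow> E (\<lambda>\<omega>. (G i (X i \<omega>))\<^sup>2) \<le> ereal (s i)"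
    and n: "1 \<le> n"
  shows "E (\<lambda>\<omega>. (max 0 (\<Sum>i=1..n. G i (X i \<omega>)))\<^sup>2) \<le> ereal (\<Sum>i=1..n. s i)"
  using n
proof (induction n rule: nat_induct_at_least)
  case base
  have G1: "(\<lambda>\<omega>. G 1 (X 1 \<omega>)) \<in> bdd_lip_past 1"
    using G by (intro bdd_lip_past_component) auto
  have "E (\<lambda>\<omega>. (max 0 (G 1 (X 1 \<omega>)))\<^sup>2) \<le> E (\<lambda>\<omega>. (G 1 (X 1 \<omega>))\<^sup>2)"
    unfolding power2_eq_square
    by (intro E_mono bdd_lip_past_in_H[of _ 1] bdd_lip_past_mult bdd_lip_past_pos G1)
       (auto simp: max_def)
  then show ?case using V[of 1] by (simp add: order_trans)
next
  case (Suc n)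
  define S where "S \<omega> = (\<Sum>i=1..n. G i (X i \<omega>))" for \<omega>
  define g where "g \<omega> = G (Suc n) (X (Suc n) \<omega>)" for \<omega>
  have S: "S \<in> bdd_lip_past m" if "n \<le> m" for m
    unfolding S_def[abs_def] using G that by (intro bdd_lip_past_sum bdd_lip_past_component) auto
  have g: "g \<in> bdd_lip_past (Suc n)"
    unfolding g_def[abs_def] using G by (intro bdd_lip_past_component) auto
  note past = bdd_lip_past_mult bdd_lip_past_pos bdd_lip_past_add bdd_lip_past_const S[OF le_SucI, OF order_refl] g
  let ?A = "\<lambda>\<omega>. max 0 (S \<omega>) * max 0 (S \<omega>)"
  let ?B = "\<lambda>\<omega>. 2 * (max 0 (S \<omega>) * g \<omega>)"
  let ?C = "\<lambda>\<omega>. g \<omega> * g \<omega>"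
  have "E (\<lambda>\<omega>. max 0 (S \<omega> + g \<omega>) * max 0 (S \<omega> + g \<omega>)) \<le> E (\<lambda>\<omega>. (?A \<omega> + ?B \<omega>) + ?C \<omega>)"
  proof (intro E_mono bdd_lip_past_in_H[of _ "Suc n"] past)
    fix \<omega>
    have "(max 0 (S \<omega> + g \<omega>))\<^sup>2 \<le> (max 0 (S \<omega>) + g \<omega>)\<^sup>2"
      by (rule abs_le_square_iff[THEN iffD1]) (auto simp: max_def)
    then show "max 0 (S \<omega> + g \<omega>) * max 0 (S \<omega> + g \<omega>) \<le> (?A \<omega> + ?B \<omega>) + ?C \<omega>"
      by (simp add: power2_eq_square algebra_simps)
  qed simp_all
  also have "\<dots> \<le> E (\<lambda>\<omega>. ?A \<omega> + ?B \<omega>) + E ?C"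
    by (intro bdd_lip_past_subadd[of _ "Suc n"] past) simp
  also have "\<dots> \<le> (E ?A + E ?B) + E ?C"
    by (intro add_right_mono bdd_lip_past_subadd[of _ "Suc n"] past) simp
  also have "E ?B = 0"
  proof -
    have "E (\<lambda>\<omega>. max 0 (S \<omega>) * g \<omega>) = 0"
      unfolding g_def using Suc.hyps G E0[of "Suc n"] by (intro E_pos_part_mult_centred[of _ n] S) auto
    moreover have "(\<lambda>\<omega>. max 0 (S \<omega>) * g \<omega>) \<in> H"
      by (intro bdd_lip_past_in_H[of _ "Suc n"] past) simp
    ultimately show ?thesis using E_scale[of _ 2] by simp
  qed
  also have "E ?A + 0 + E ?C \<le> (ereal (\<Sum>i=1..n. s i) + 0) + ereal (s (Suc n))"
    by (intro add_mono order_refl)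
       (use Suc.IH V[of "Suc n"] in \<open>simp_all add: S_def g_def power2_eq_square\<close>)
  finally show ?case by (simp add: S_def g_def power2_eq_square)
qed

text \<open>
  This replaces the Borel--Cantelli argument: under \<open>Q\<close> the series has finite expectation, so it
  converges almost surely, and its terms tend to \<open>0\<close>.
\<close>

lemma AE_summable_if_E_le:
  assumes Q: "Q \<in> P" and F: "\<And>n. F n \<in> H" "\<And>n \<omega>. \<omega> \<in> space M \<Longrightarrow> 0 \<le> F n \<omega>"
    and t: "\<And>n. E (F n) \<le> ereal (t n)" "summable (\<lambda>n. t n / w n)" and w: "\<And>n. 0 < w n"
  shows "AE \<omega> in Q. summable (\<lambda>n. F n \<omega> / w n)"
proof -
  have [measurable]: "F n \<in> borel_measurable Q" for n using F(1) Q by (rule P_measurable)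
  have t0: "0 \<le> t n" for n using order_trans[OF E_nonneg[OF F] t(1)] by simp
  have int: "(\<integral>\<^sup>+\<omega>. ennreal (F n \<omega> / w n) \<partial>Q) \<le> ennreal (t n / w n)" for n
  proof (rule nn_integral_le_if_E_le[OF _ _ Q])
    have "0 \<le> 1 / w n" using w[of n] by simp
    then show "(\<lambda>\<omega>. F n \<omega> / w n) \<in> H"
      using F(1)[of n] by (intro lipschitz_comp_in_H[where K = "1 / w n" and g = "\<lambda>x. x / w n"])
        (auto simp: diff_divide_distrib[symmetric])
    have "E (\<lambda>\<omega>. 1 / w n * F n \<omega>) = ereal (1 / w n) * E (F n)"
      using F(1) \<open>0 \<le> 1 / w n\<close> by (rule E_scale)
    also have "\<dots> \<le> ereal (1 / w n) * ereal (t n)"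
      using t(1) \<open>0 \<le> 1 / w n\<close> by (intro ereal_mult_left_mono) auto
    finally show "E (\<lambda>\<omega>. F n \<omega> / w n) \<le> ereal (t n / w n)" by simp
    show "0 \<le> F n \<omega> / w n" if "\<omega> \<in> space M" for \<omega>
      using F(2)[OF that] w[of n] by simp
  qed
  have "(\<integral>\<^sup>+\<omega>. (\<Sum>n. ennreal (F n \<omega> / w n)) \<partial>Q) = (\<Sum>n. \<integral>\<^sup>+\<omega>. ennreal (F n \<omega> / w n) \<partial>Q)"
    by (intro nn_integral_suminf) measurable
  also have "\<dots> \<le> (\<Sum>n. ennreal (t n / w n))" using int by (intro suminf_le) auto
  also have "\<dots> = ennreal (\<Sum>n. t n / w n)"
    using t(2) t0 w by (intro suminf_ennreal2) (auto intro: divide_nonneg_pos)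
  finally have "(\<integral>\<^sup>+\<omega>. (\<Sum>n. ennreal (F n \<omega> / w n)) \<partial>Q) \<noteq> \<infinity>" by (auto simp: top_unique)
  then have "AE \<omega> in Q. (\<Sum>n. ennreal (F n \<omega> / w n)) \<noteq> \<infinity>"
    by (intro nn_integral_PInf_AE) measurable
  moreover have "AE \<omega> in Q. \<omega> \<in> space M" using P_space[OF Q] by (intro AE_I2) simp
  ultimately show ?thesis
    by eventually_elim (use F(2) w in \<open>auto intro!: summable_suminf_not_top divide_nonneg_pos\<close>)
qed

text \<open>
  The squares of the normalised positive parts have summable expectations, by the one-sided variance
  bound and the geometric growth of the subsequence.
\<close>

lemma AE_geometric_means_pos_part:
  assumes Q: "Q \<in> P" and \<alpha>: "1 < \<alpha>"
    and G: "\<And>i. 1 \<le> i \<Longrightarrow> G i \<in> bdd_lip_real"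
    and E0: "\<And>i. 1 \<le> i \<Longrightarrow> E (\<lambda>\<omega>. G i (X i \<omega>)) = 0"
    and V: "\<And>i. 1 \<le> i \<Longrightarrow> E (\<lambda>\<omega>. (G i (X i \<omega>))\<^sup>2) \<le> ereal (s i)"
    and s: "\<And>i. 0 \<le> s i" "summable (\<lambda>i. s i / (real i)\<^sup>2)"
  shows "AE \<omega> in Q. (\<lambda>n. max 0 (\<Sum>i=1..nat \<lfloor>\<alpha> ^ n\<rfloor>. G i (X i \<omega>)) / \<alpha> ^ n) \<longlonglongrightarrow> 0"
proof -
  define T where "T n \<omega> = max 0 (\<Sum>i=1..nat \<lfloor>\<alpha> ^ n\<rfloor>. G i (X i \<omega>))" for n \<omega>
  have N1: "1 \<le> nat \<lfloor>\<alpha> ^ n\<rfloor>" for n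
    using one_le_power[of \<alpha> n] \<alpha> by (simp add: le_nat_iff le_floor_iff)
  have Tsq: "(\<lambda>\<omega>. (T n \<omega>)\<^sup>2) \<in> bdd_lip_past (nat \<lfloor>\<alpha> ^ n\<rfloor>)" for n
    unfolding T_def power2_eq_square using G
    by (intro bdd_lip_past_mult bdd_lip_past_pos bdd_lip_past_sum bdd_lip_past_component) auto
  have "AE \<omega> in Q. summable (\<lambda>n. (T n \<omega>)\<^sup>2 / (\<alpha> ^ n)\<^sup>2)"
  proof (rule AE_summable_if_E_le[OF Q bdd_lip_past_in_H[OF Tsq N1]])
    show "E (\<lambda>\<omega>. (T n \<omega>)\<^sup>2) \<le> ereal (\<Sum>i=1..nat \<lfloor>\<alpha> ^ n\<rfloor>. s i)" for n
      unfolding T_def by (rule E_pos_part_sum_sq_le[OF G E0 V N1])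
    show "summable (\<lambda>n. (\<Sum>i=1..nat \<lfloor>\<alpha> ^ n\<rfloor>. s i) / (\<alpha> ^ n)\<^sup>2)"
      by (rule summable_geometric_block_means[OF \<alpha> s])
  qed (use \<alpha> in auto)
  then show ?thesis
  proof eventually_elim
    case (elim \<omega>)
    then have "(\<lambda>n. sqrt ((T n \<omega>)\<^sup>2 / (\<alpha> ^ n)\<^sup>2)) \<longlonglongrightarrow> sqrt 0"
      by (intro tendsto_real_sqrt summable_LIMSEQ_zero)
    moreover have "sqrt ((T n \<omega>)\<^sup>2 / (\<alpha> ^ n)\<^sup>2) = T n \<omega> / \<alpha> ^ n" for n
      using \<alpha> by (simp add: real_sqrt_divide T_def)
    ultimately show ?case by (simp add: T_def)
  qed
qed

section \<open>The two halves of the strong law\<close>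

text \<open>
  The right-hand side does not depend on the measure, because the uniform bound is applied on each
  block separately.
\<close>

lemma E_le_block_sum:
  assumes f: "(\<lambda>\<omega>. f (X 1 \<omega>)) \<in> H" "\<And>x. 0 \<le> x \<Longrightarrow> 0 \<le> f x" "f 0 = 0"
    and fc: "\<And>k x. real k < x \<Longrightarrow> x \<le> real k + 1 \<Longrightarrow> f x \<le> c k * x"
    and c: "\<And>k. 0 \<le> c k" "summable (\<lambda>k. c k * b k)"
  shows "E (\<lambda>\<omega>. f (X 1 \<omega>)) \<le> ereal (\<Sum>k. c k * b k)"
proof (rule E_le_if_nn_integral_le[OF f(1)])
  show "0 \<le> f (X 1 \<omega>)" if "\<omega> \<in> space M" for \<omega> using f(2) X_nonneg that by simp
  show "0 \<le> (\<Sum>k. c k * b k)" using c b_nonneg by (intro suminf_nonneg) auto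
  fix Q assume Q: "Q \<in> P"
  let ?I = "\<lambda>k x. ennreal x * indicator {real k<..real (k + 1)} x"
  have [measurable]: "X 1 \<in> borel_measurable Q" using X_in_H Q by (intro P_measurable) auto
  have pt: "ennreal (f x) \<le> (\<Sum>k. ennreal (c k) * ?I k x)" if "0 \<le> x" for x
  proof (cases "x = 0")
    case False
    define k where "k = nat (\<lceil>x\<rceil> - 1)"
    have k: "real k < x" "x \<le> real k + 1" using that False unfolding k_def by linarith+
    have "ennreal (f x) \<le> ennreal (c k * x)" using fc k by (intro ennreal_leI) auto
    also have "\<dots> = (\<Sum>j\<in>{k}. ennreal (c j) * ?I j x)"
      using k c(1) by (simp add: ennreal_mult')
    also have "\<dots> \<le> (\<Sum>k. ennreal (c k) * ?I k x)"
      by (intro sum_le_suminf) auto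
    finally show ?thesis .
  qed (simp add: f(3))
  have "(\<integral>\<^sup>+\<omega>. ennreal (f (X 1 \<omega>)) \<partial>Q) \<le> (\<integral>\<^sup>+\<omega>. (\<Sum>k. ennreal (c k) * ?I k (X 1 \<omega>)) \<partial>Q)"
    using pt X_nonneg P_space[OF Q] by (intro nn_integral_mono) auto
  also have "\<dots> = (\<Sum>k. ennreal (c k) * (\<integral>\<^sup>+\<omega>. ?I k (X 1 \<omega>) \<partial>Q))"
  proof (subst nn_integral_suminf)
    show "(\<lambda>\<omega>. ennreal (c k) * ?I k (X 1 \<omega>)) \<in> borel_measurable Q" for k by measurable
    show "(\<Sum>k. \<integral>\<^sup>+\<omega>. ennreal (c k) * ?I k (X 1 \<omega>) \<partial>Q)
        = (\<Sum>k. ennreal (c k) * (\<integral>\<^sup>+\<omega>. ?I k (X 1 \<omega>) \<partial>Q))"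
      by (intro suminf_cong nn_integral_cmult) measurable
  qed
  also have "\<dots> \<le> (\<Sum>k. ennreal (c k * b k))"
    using block_bound[OF Q] c(1) by (intro suminf_le) (auto simp: ennreal_mult' intro!: mult_left_mono)
  also have "\<dots> = ennreal (\<Sum>k. c k * b k)"
    using c b_nonneg by (intro suminf_ennreal2) auto
  finally show "(\<integral>\<^sup>+\<omega>. ennreal (f (X 1 \<omega>)) \<partial>Q) \<le> ennreal (\<Sum>k. c k * b k)" .
qed

lemma E_X1_finite: "\<bar>E (X 1)\<bar> \<noteq> \<infinity>" and E_X1_nonneg: "0 \<le> E (X 1)"
proof -
  have "E (\<lambda>\<omega>. X 1 \<omega>) \<le> ereal (\<Sum>k. 1 * b k)"
    using X_in_H b_summable by (intro E_le_block_sum[where f = "\<lambda>x. x"]) auto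
  moreover show "0 \<le> E (X 1)" using X_in_H X_nonneg by (intro E_nonneg) auto
  ultimately show "\<bar>E (X 1)\<bar> \<noteq> \<infinity>" by auto
qed

text \<open>
  The variable \<open>X i\<close> is truncated at level \<open>i\<close>. The truncated means are at most \<open>E (X 1)\<close>, and the
  bound \<open>3\<close> on the weights makes the truncated second moments, divided by \<open>i\<^sup>2\<close>, summable. The latter
  fact is used twice: for the one-sided variance estimate, and to see that the truncation is
  eventually void, since \<open>(min x i)\<^sup>2 / i\<^sup>2 = 1\<close> whenever \<open>x \<ge> i\<close>.
\<close>

lemma AE_limsup_mean_le:
  assumes Q: "Q \<in> P"
  shows "AE \<omega> in Q. limsup (\<lambda>n. ereal ((\<Sum>i=1..n. X i \<omega>) / real n)) \<le> E (X 1)"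
proof -
  obtain \<mu> where \<mu>: "E (X 1) = ereal \<mu>" "0 \<le> \<mu>"
    using E_X1_finite E_X1_nonneg by (cases "E (X 1)") auto
  define e where "e i = real_of_ereal (E (\<lambda>\<omega>. trunc (real i) (X 1 \<omega>)))" for i :: nat
  have trunc_in: "trunc (real i) \<in> bdd_lip_real" for i by (simp add: trunc_bdd_lip)
  have e: "E (\<lambda>\<omega>. trunc (real i) (X j \<omega>)) = ereal (e i)" if "1 \<le> j" for i j
    unfolding E_comp_eq[OF trunc_in that] e_def using E_comp_finite[OF trunc_in, of 1] by (simp add: ereal_real)
  have e0: "0 \<le> e i" for i
    using E_nonneg[OF comp_in_H[OF trunc_in[of i] order_refl]] e[of 1 i] by (simp add: trunc_def)
  have e\<mu>: "e i \<le> \<mu>" for i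
  proof -
    have "E (\<lambda>\<omega>. trunc (real i) (X 1 \<omega>)) \<le> E (X 1)"
      using X_in_H X_nonneg comp_in_H[OF trunc_in] by (intro E_mono) (auto simp: trunc_def)
    then show ?thesis using e[of 1 i] \<mu> by simp
  qed
  define G where "G i x = trunc (real i) x + - e i" for i :: nat and x
  have G: "G i \<in> bdd_lip_real" for i
    unfolding G_def[abs_def] by (intro bdd_lip_add bdd_lip_const trunc_in) simp
  have EG: "E (\<lambda>\<omega>. G i (X i \<omega>)) = 0" if "1 \<le> i" for i
    unfolding G_def
    by (subst E_add_const[OF comp_in_H[OF trunc_in that] E_comp_finite[OF trunc_in that]])
       (simp add: e[OF that])
  define u where "u i = (\<Sum>k. sq_weight k i * b k)" for i
  have u0: "0 \<le> u i" for i
    unfolding u_def using b_nonneg sq_weight_nonneg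
    by (intro suminf_nonneg summable_sq_weight_averages b_summable) auto
  have sq_in: "(\<lambda>x. (trunc (real i) x)\<^sup>2) \<in> bdd_lip_real" for i
    unfolding power2_eq_square by (intro bdd_lip_mult trunc_in)
  have Esq: "E (\<lambda>\<omega>. (trunc (real i) (X j \<omega>))\<^sup>2) \<le> ereal (u i)" if "1 \<le> j" for i j
    unfolding E_comp_eq[OF sq_in that] u_def
    by (intro E_le_block_sum[where f = "\<lambda>x. (trunc (real i) x)\<^sup>2"] comp_in_H sq_in trunc_sq_le_sq_weight
          sq_weight_nonneg summable_sq_weight_averages b_summable b_nonneg)
       (auto simp: trunc_def)
  have VG: "E (\<lambda>\<omega>. (G i (X i \<omega>))\<^sup>2) \<le> ereal (u i + \<mu>\<^sup>2)" if i: "1 \<le> i" for i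
  proof -
    have sq: "(\<lambda>x. (G i x)\<^sup>2) \<in> bdd_lip_real" unfolding power2_eq_square by (intro bdd_lip_mult G)
    have sq': "(\<lambda>x. (trunc (real i) x)\<^sup>2 + \<mu>\<^sup>2) \<in> bdd_lip_real"
      by (intro bdd_lip_add bdd_lip_const sq_in) simp
    have "E (\<lambda>\<omega>. (G i (X i \<omega>))\<^sup>2) \<le> E (\<lambda>\<omega>. (trunc (real i) (X i \<omega>))\<^sup>2 + \<mu>\<^sup>2)"
    proof (intro E_mono comp_in_H[OF sq i] comp_in_H[OF sq' i])
      fix \<omega>
      \<comment> \<open>For \<open>t, e \<ge> 0\<close> the mixed term in \<open>(t - e)\<^sup>2\<close> can be dropped.\<close>
      have "0 \<le> trunc (real i) (X i \<omega>) * e i" using e0 by (simp add: trunc_def)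
      moreover have "(e i)\<^sup>2 \<le> \<mu>\<^sup>2" using e0 e\<mu> by (simp add: power_mono)
      ultimately show "(G i (X i \<omega>))\<^sup>2 \<le> (trunc (real i) (X i \<omega>))\<^sup>2 + \<mu>\<^sup>2"
        by (simp add: G_def power2_eq_square algebra_simps)
    qed
    also have "\<dots> = E (\<lambda>\<omega>. (trunc (real i) (X i \<omega>))\<^sup>2) + ereal (\<mu>\<^sup>2)"
      by (intro E_add_const comp_in_H[OF sq_in i] E_comp_finite[OF sq_in i])
    also have "\<dots> \<le> ereal (u i) + ereal (\<mu>\<^sup>2)" by (intro add_right_mono Esq i)
    finally show ?thesis by simp
  qed
  have su: "summable (\<lambda>i. u i / (real i)\<^sup>2)"
    unfolding u_def by (intro summable_sq_weight_averages b_nonneg b_summable)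
  have "summable (\<lambda>i. \<mu>\<^sup>2 * (inverse (real i ^ 2)))"
    by (intro summable_mult inverse_power_summable) simp
  then have sG: "summable (\<lambda>i. (u i + \<mu>\<^sup>2) / (real i)\<^sup>2)"
    using summable_add[OF su, of "\<lambda>i. \<mu>\<^sup>2 * inverse (real i ^ 2)"]
    by (simp add: divide_inverse distrib_right)
  have geo: "AE \<omega> in Q. (\<lambda>n. max 0 (\<Sum>i=1..nat \<lfloor>\<alpha> ^ n\<rfloor>. trunc (real i) (X i \<omega>) - e i) / \<alpha> ^ n) \<longlonglongrightarrow> 0"
    if \<alpha>: "1 < \<alpha>" for \<alpha>
    using AE_geometric_means_pos_part[OF Q \<alpha> G EG VG _ sG] u0 by (simp add: G_def)
  have ev: "AE \<omega> in Q. \<forall>\<^sub>F i in sequentially. X i \<omega> \<le> trunc (real i) (X i \<omega>)"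
  proof -
    let ?T = "\<lambda>i \<omega>. (trunc (real (Suc i)) (X (Suc i) \<omega>))\<^sup>2"
    have "AE \<omega> in Q. summable (\<lambda>i. ?T i \<omega> / (real (Suc i))\<^sup>2)"
      using Esq[of "Suc _" "Suc _"] summable_Suc_iff[THEN iffD2, OF su]
      by (intro AE_summable_if_E_le[OF Q, where t = "\<lambda>i. u (Suc i)"] comp_in_H[OF sq_in]) auto
    then show ?thesis
    proof eventually_elim
      case (elim \<omega>)
      then have "\<forall>\<^sub>F i in sequentially. ?T i \<omega> / (real (Suc i))\<^sup>2 < 1"
        by (intro order_tendstoD(2)[OF summable_LIMSEQ_zero]) simp_all
      then have "\<forall>\<^sub>F i in sequentially. X (Suc i) \<omega> \<le> trunc (real (Suc i)) (X (Suc i) \<omega>)"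
      proof (rule eventually_mono)
        fix i assume "?T i \<omega> / (real (Suc i))\<^sup>2 < 1"
        then have "?T i \<omega> < (real (Suc i))\<^sup>2" by (simp add: divide_less_eq)
        then have "trunc (real (Suc i)) (X (Suc i) \<omega>) < real (Suc i)" by (rule power2_less_imp_less) simp
        then show "X (Suc i) \<omega> \<le> trunc (real (Suc i)) (X (Suc i) \<omega>)"
          unfolding trunc_def by linarith
      qed
      then show ?case
        by (subst eventually_sequentially_Suc[symmetric])
    qed
  qed
  have all: "AE \<omega> in Q. \<forall>j. (\<lambda>n. max 0 (\<Sum>i=1..nat \<lfloor>(1 + inverse (real (Suc j))) ^ n\<rfloor>.
      trunc (real i) (X i \<omega>) - e i) / (1 + inverse (real (Suc j))) ^ n) \<longlonglongrightarrow> 0"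
    by (subst AE_all_countable) (intro allI geo, simp)
  have sp: "AE \<omega> in Q. \<omega> \<in> space M" using P_space[OF Q] by (intro AE_I2) simp
  from all ev sp show ?thesis
  proof eventually_elim
    case (elim \<omega>)
    let ?L = "limsup (\<lambda>n. ereal ((\<Sum>i=1..n. X i \<omega>) / real n))"
    have le: "?L \<le> ereal ((1 + inverse (real (Suc j))) * \<mu>)" for j
      by (rule mean_limsup_le[OF _ \<mu>(2) e\<mu> _ _ elim(2) elim(1)[rule_format]])
         (use X_nonneg elim(3) in \<open>auto simp: trunc_def\<close>)
    have lim: "(\<lambda>j. ereal ((1 + inverse (real (Suc j))) * \<mu>)) \<longlonglongrightarrow> ereal ((1 + 0) * \<mu>)"
      by (intro tendsto_intros LIMSEQ_inverse_real_of_nat)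
    have "?L \<le> ereal ((1 + 0) * \<mu>)" using LIMSEQ_le_const[OF lim] le by blast
    then show "?L \<le> E (X 1)" unfolding \<mu>(1) by simp
  qed
qed

text \<open>
  The lower expectation of \<open>min (X 1) c\<close> falls short of that of \<open>X 1\<close> by at most the upper expectation
  of the excess \<open>(X 1 - c)\<^sup>+\<close>. Only the blocks with \<open>k \<ge> c\<close> enter, and their tail sum tends to \<open>0\<close> as
  \<open>c\<close> grows. This uniform integrability is where a finite upper expectation alone would not suffice.
\<close>

lemma neg_E_neg_le_trunc:
  "- E (\<lambda>\<omega>. - X 1 \<omega>) \<le> - E (\<lambda>\<omega>. - trunc (real c) (X 1 \<omega>)) + ereal (suminf b - (\<Sum>k<c. b k))"
proof -
  have neg_in: "(\<lambda>\<omega>. - X 1 \<omega>) \<in> H"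
    using X_in_H by (intro lipschitz_comp_in_H[where K = 1 and g = uminus]) auto
  have exc_in: "(\<lambda>\<omega>. max 0 (X 1 \<omega> - real c)) \<in> H"
    using X_in_H by (intro lipschitz_comp_in_H[where K = 1 and g = "\<lambda>x. max 0 (x - real c)"]) auto
  have trunc_in: "(\<lambda>x. - trunc (real c) x) \<in> bdd_lip_real"
    by (rule bdd_lip_contraction[OF trunc_bdd_lip]) auto
  have neg_fin: "\<bar>E (\<lambda>\<omega>. - X 1 \<omega>)\<bar> \<noteq> \<infinity>"
  proof -
    have "E (\<lambda>\<omega>. - X 1 \<omega>) \<le> ereal 0" using neg_in X_nonneg by (intro E_le_const) auto
    moreover have "E (\<lambda>\<omega>. X 1 \<omega> + - X 1 \<omega>) \<le> E (X 1) + E (\<lambda>\<omega>. - X 1 \<omega>)"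
      using E_X1_finite X_in_H neg_in by (intro E_subadd) auto
    ultimately show ?thesis using E_X1_finite E_const[of 0]
      by (cases "E (X 1)"; cases "E (\<lambda>\<omega>. - X 1 \<omega>)") auto
  qed
  have tail: "(\<lambda>k. (if c \<le> k then 1 else 0) * b k) sums (suminf b - (\<Sum>k<c. b k))"
  proof -
    have "(\<lambda>k. b k - (if k \<in> {..<c} then b k else 0)) sums (suminf b - (\<Sum>k<c. b k))"
      by (intro sums_diff summable_sums b_summable sums_If_finite_set) simp
    moreover have "(\<lambda>k. b k - (if k \<in> {..<c} then b k else 0)) = (\<lambda>k. (if c \<le> k then 1 else 0) * b k)"
      by auto
    ultimately show ?thesis by simp
  qed
  have "E (\<lambda>\<omega>. max 0 (X 1 \<omega> - real c)) \<le> ereal (\<Sum>k. (if c \<le> k then 1 else 0) * b k)"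
    using exc_in sums_summable[OF tail]
    by (intro E_le_block_sum[where f = "\<lambda>x. max 0 (x - real c)"]) auto
  then have exc: "E (\<lambda>\<omega>. max 0 (X 1 \<omega> - real c)) \<le> ereal (suminf b - (\<Sum>k<c. b k))"
    using sums_unique[OF tail] by simp
  have "E (\<lambda>\<omega>. - trunc (real c) (X 1 \<omega>)) \<le> E (\<lambda>\<omega>. - X 1 \<omega> + max 0 (X 1 \<omega> - real c))"
  proof (rule E_mono[OF _ comp_in_H[OF trunc_in order_refl]])
    show "(\<lambda>\<omega>. - X 1 \<omega> + max 0 (X 1 \<omega> - real c)) \<in> H"
    proof -
      have "- x + max 0 (x - real c) = - min x (real c)" for x by simp
      then show ?thesis
        using X_in_H by (simp only:) (rule lipschitz_comp_in_H[where K = 1 and g = "\<lambda>x. - min x (real c)"], auto)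
    qed
    show "- trunc (real c) (X 1 \<omega>) \<le> - X 1 \<omega> + max 0 (X 1 \<omega> - real c)" if "\<omega> \<in> space M" for \<omega>
      using X_nonneg[OF order_refl that] by (auto simp: trunc_def max_def min_def)
  qed
  also have "\<dots> \<le> E (\<lambda>\<omega>. - X 1 \<omega>) + E (\<lambda>\<omega>. max 0 (X 1 \<omega> - real c))"
    using neg_fin by (intro E_subadd neg_in exc_in) auto
  also have "\<dots> \<le> E (\<lambda>\<omega>. - X 1 \<omega>) + ereal (suminf b - (\<Sum>k<c. b k))"
    using exc by (rule add_left_mono)
  finally show ?thesis
    using neg_fin E_comp_finite[OF trunc_in order_refl]
    by (cases "E (\<lambda>\<omega>. - X 1 \<omega>)"; cases "E (\<lambda>\<omega>. - trunc (real c) (X 1 \<omega>))") auto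
qed

text \<open>
  For the lower bound a fixed truncation level is enough, since discarding the excess only decreases
  the sums of non-negative variables. The second moments are then bounded by \<open>c\<^sup>2\<close>, and the upper
  estimate is applied to the variables \<open>- min (X i) c\<close>.
\<close>

lemma AE_liminf_mean_ge_trunc:
  assumes Q: "Q \<in> P"
  shows "AE \<omega> in Q. - E (\<lambda>\<omega>. - trunc (real c) (X 1 \<omega>))
    \<le> liminf (\<lambda>n. ereal ((\<Sum>i=1..n. X i \<omega>) / real n))"
proof -
  define \<nu> where "\<nu> = real_of_ereal (- E (\<lambda>\<omega>. - trunc (real c) (X 1 \<omega>)))"
  have trunc_in: "(\<lambda>x. - trunc (real c) x) \<in> bdd_lip_real"
    by (rule bdd_lip_contraction[OF trunc_bdd_lip]) auto
  have \<nu>: "E (\<lambda>\<omega>. - trunc (real c) (X i \<omega>)) = ereal (- \<nu>)" if "1 \<le> i" for i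
    unfolding E_comp_eq[OF trunc_in that] \<nu>_def using E_comp_finite[OF trunc_in order_refl]
    by (cases "E (\<lambda>\<omega>. - trunc (real c) (X 1 \<omega>))") auto
  have "ereal (- \<nu>) \<le> ereal 0"
    unfolding \<nu>[OF order_refl, symmetric]
    by (intro E_le_const comp_in_H[OF trunc_in order_refl]) (simp add: trunc_def)
  moreover have "0 \<le> E (\<lambda>\<omega>. - trunc (real c) (X 1 \<omega>) + real c)"
    using lipschitz_comp_in_H[OF comp_in_H[OF trunc_in order_refl], where K = 1 and g = "\<lambda>x. x + real c"]
    by (intro E_nonneg) (auto simp: trunc_def)
  ultimately have \<nu>c: "0 \<le> \<nu>" "\<nu> \<le> real c"
    unfolding E_add_const[OF comp_in_H[OF trunc_in order_refl] E_comp_finite[OF trunc_in order_refl]]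
      \<nu>[OF order_refl] by auto
  define G where "G x = - trunc (real c) x + \<nu>" for x
  have G: "G \<in> bdd_lip_real"
    unfolding G_def[abs_def] by (intro bdd_lip_add bdd_lip_const trunc_in) simp
  have EG: "E (\<lambda>\<omega>. G (X i \<omega>)) = 0" if "1 \<le> i" for i
    unfolding G_def
    by (subst E_add_const[OF comp_in_H[OF trunc_in that] E_comp_finite[OF trunc_in that]])
       (simp add: \<nu>[OF that])
  have VG: "E (\<lambda>\<omega>. (G (X i \<omega>))\<^sup>2) \<le> ereal ((real c)\<^sup>2)" if "1 \<le> i" for i
  proof (rule E_le_const)
    show "(\<lambda>\<omega>. (G (X i \<omega>))\<^sup>2) \<in> H"
      unfolding power2_eq_square using bdd_lip_mult[OF G G] that by (rule comp_in_H)
    fix \<omega>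
    have "\<bar>G (X i \<omega>)\<bar> \<le> real c" unfolding G_def trunc_def using \<nu>c by linarith
    then show "(G (X i \<omega>))\<^sup>2 \<le> (real c)\<^sup>2" by (rule power2_le_iff_abs_le[THEN iffD2, rotated]) simp
  qed
  have "summable (\<lambda>i. (real c)\<^sup>2 * (inverse (real i ^ 2)))"
    by (intro summable_mult inverse_power_summable) simp
  then have sG: "summable (\<lambda>i. (real c)\<^sup>2 / (real i)\<^sup>2)" by (simp add: divide_inverse)
  have geo: "AE \<omega> in Q. (\<lambda>n. max 0 (\<Sum>i=1..nat \<lfloor>\<alpha> ^ n\<rfloor>. \<nu> - trunc (real c) (X i \<omega>)) / \<alpha> ^ n) \<longlonglongrightarrow> 0"
    if \<alpha>: "1 < \<alpha>" for \<alpha>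
    using AE_geometric_means_pos_part[OF Q \<alpha> G EG VG _ sG] by (simp add: G_def)
  have all: "AE \<omega> in Q. \<forall>j. (\<lambda>n. max 0 (\<Sum>i=1..nat \<lfloor>(1 + inverse (real (Suc j))) ^ n\<rfloor>.
      \<nu> - trunc (real c) (X i \<omega>)) / (1 + inverse (real (Suc j))) ^ n) \<longlonglongrightarrow> 0"
    by (subst AE_all_countable) (intro allI geo, simp)
  have sp: "AE \<omega> in Q. \<omega> \<in> space M" using P_space[OF Q] by (intro AE_I2) simp
  from all sp show ?thesis
  proof eventually_elim
    case (elim \<omega>)
    let ?L = "liminf (\<lambda>n. ereal ((\<Sum>i=1..n. X i \<omega>) / real n))"
    have le: "ereal (\<nu> / (1 + inverse (real (Suc j)))) \<le> ?L" for j
      by (rule mean_liminf_ge[OF _ \<nu>c(1) _ _ elim(1)[rule_format]])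
         (use X_nonneg elim(2) in \<open>auto simp: trunc_def\<close>)
    have lim: "(\<lambda>j. ereal (\<nu> / (1 + inverse (real (Suc j))))) \<longlonglongrightarrow> ereal (\<nu> / (1 + 0))"
      by (intro tendsto_intros LIMSEQ_inverse_real_of_nat) simp
    have "ereal (\<nu> / (1 + 0)) \<le> ?L" using LIMSEQ_le_const2[OF lim] le by blast
    then show "- E (\<lambda>\<omega>. - trunc (real c) (X 1 \<omega>)) \<le> ?L"
      unfolding \<nu>[OF order_refl] by simp
  qed
qed

text \<open>
  Let \<open>c\<close> tend to infinity.
\<close>

lemma AE_liminf_mean_ge:
  assumes Q: "Q \<in> P"
  shows "AE \<omega> in Q. - E (\<lambda>\<omega>. - X 1 \<omega>) \<le> liminf (\<lambda>n. ereal ((\<Sum>i=1..n. X i \<omega>) / real n))"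
proof -
  have "AE \<omega> in Q. \<forall>c::nat. - E (\<lambda>\<omega>. - trunc (real c) (X 1 \<omega>))
    \<le> liminf (\<lambda>n. ereal ((\<Sum>i=1..n. X i \<omega>) / real n))"
    by (subst AE_all_countable) (intro allI AE_liminf_mean_ge_trunc Q)
  then show ?thesis
  proof eventually_elim
    case (elim \<omega>)
    show ?case
    proof (rule ereal_le_epsilon2)
      fix \<epsilon> :: real assume "0 < \<epsilon>"
      have "(\<lambda>c. suminf b - (\<Sum>k<c. b k)) \<longlonglongrightarrow> suminf b - suminf b"
        by (intro tendsto_intros summable_LIMSEQ b_summable)
      then have "\<forall>\<^sub>F c in sequentially. suminf b - (\<Sum>k<c. b k) < \<epsilon>"
        by (rule order_tendstoD(2)) (use \<open>0 < \<epsilon>\<close> in simp)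
      then obtain c where c: "suminf b - (\<Sum>k<c. b k) < \<epsilon>"
        by (blast dest: eventually_happens'[OF sequentially_bot])
      have "- E (\<lambda>\<omega>. - X 1 \<omega>) \<le> - E (\<lambda>\<omega>. - trunc (real c) (X 1 \<omega>)) + ereal (suminf b - (\<Sum>k<c. b k))"
        by (rule neg_E_neg_le_trunc)
      also have "\<dots> \<le> liminf (\<lambda>n. ereal ((\<Sum>i=1..n. X i \<omega>) / real n)) + ereal \<epsilon>"
        using elim c by (intro add_mono) auto
      finally show "- E (\<lambda>\<omega>. - X 1 \<omega>) \<le> liminf (\<lambda>n. ereal ((\<Sum>i=1..n. X i \<omega>) / real n)) + ereal \<epsilon>" .
    qed
  qed
qed

section \<open>From the representing measures to the capacity\<close>

text \<open>
  The capacity of \<open>A\<close> is the supremum of the \<open>Q\<close>-probabilities of \<open>A\<close>.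
\<close>

lemma capacity_eq_0_if_AE:
  assumes A: "A \<in> sets M" and AE: "\<And>Q. Q \<in> P \<Longrightarrow> AE \<omega> in Q. \<omega> \<notin> A"
  shows "capacity E A = 0"
proof (rule antisym)
  have "(\<integral>\<^sup>+\<omega>. ennreal (indicator A \<omega>) \<partial>Q) \<le> ennreal 0" if "Q \<in> P" for Q
  proof -
    have "(\<integral>\<^sup>+\<omega>. ennreal (indicator A \<omega>) \<partial>Q) = (\<integral>\<^sup>+\<omega>. 0 \<partial>Q)"
    proof (rule nn_integral_cong_AE)
      show "AE \<omega> in Q. ennreal (indicator A \<omega>) = 0" using AE[OF that] by eventually_elim simp
    qed
    then show ?thesis by simp
  qed
  then have "E (indicator A) \<le> ereal 0"
    using indicator_in_H[OF A] by (intro E_le_if_nn_integral_le) auto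
  then show "capacity E A \<le> 0" by (simp add: capacity_def zero_ereal_def)
  show "0 \<le> capacity E A"
    unfolding capacity_def using indicator_in_H[OF A] by (intro E_nonneg) auto
qed

end

text \<open>
  A law on the line is determined by its distribution function, so the Lebesgue--Stieltjes measure of
  \<open>distribution_function Q Y\<close> is the law of \<open>Y\<close> under \<open>Q\<close>.
\<close>

lemma nn_integral_interval_measure_distribution:
  assumes "prob_space Q" and [measurable]: "Y \<in> borel_measurable Q" "g \<in> borel_measurable borel"
  shows "(\<integral>\<^sup>+x. g x \<partial>interval_measure (distribution_function Q Y)) = (\<integral>\<^sup>+\<omega>. g (Y \<omega>) \<partial>Q)"
proof -
  interpret prob_space Q by fact
  interpret D: real_distribution "distr Q borel Y" by (rule real_distribution_distr) simp
  have F: "distribution_function Q Y = cdf (distr Q borel Y)"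
    by (auto simp: distribution_function_def cdf_def measure_distr vimage_def Int_def fun_eq_iff
        intro!: arg_cong[where f = "measure Q"])
  have "interval_measure (cdf (distr Q borel Y)) = distr Q borel Y"
  proof (rule cdf_unique)
    show "real_distribution (interval_measure (cdf (distr Q borel Y)))"
      by (intro real_distribution_interval_measure D.cdf_nondecreasing D.cdf_is_right_cont
          D.cdf_lim_at_bot D.cdf_lim_at_top_prob)
    show "cdf (interval_measure (cdf (distr Q borel Y))) = cdf (distr Q borel Y)"
      by (intro cdf_interval_measure D.cdf_nondecreasing D.cdf_is_right_cont D.cdf_lim_at_bot)
  qed (rule D.real_distribution_axioms)
  then show ?thesis unfolding F by (simp add: nn_integral_distr)
qed

theorem theorem1:
  fixes M :: "'a measure" and H :: "('a \<Rightarrow> real) set" and E :: "('a \<Rightarrow> real) \<Rightarrow> ereal"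
    and P :: "'a measure set" and X :: "nat \<Rightarrow> 'a \<Rightarrow> real"
  assumes "sublinear_expectation_space M H E"
    and "lower_continuous M H E"
    and "represents M H E P"
    and "\<And>n. n \<ge> 1 \<Longrightarrow> X n \<in> H"
    and "\<And>n \<omega>. n \<ge> 1 \<Longrightarrow> \<omega> \<in> space M \<Longrightarrow> 0 \<le> X n \<omega>"
    and "independent_seq H E X"
    and "\<And>i j. i \<ge> 1 \<Longrightarrow> j \<ge> 1 \<Longrightarrow> identically_distributed E [X i] E [X j]"
    and "(\<Sum>k::nat. SUP Q\<in>P. \<integral>\<^sup>+x\<in>{real k<..real (k + 1)}. ennreal x
            \<partial>interval_measure (distribution_function Q (X 1))) < \<infinity>"
  shows "capacity E
     ({\<omega>\<in>space M. limsup (\<lambda>n. ereal ((\<Sum>i=1..n. X i \<omega>) / real n)) > E (X 1)} \<union>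
      {\<omega>\<in>space M. liminf (\<lambda>n. ereal ((\<Sum>i=1..n. X i \<omega>) / real n)) < - E (\<lambda>\<omega>. - X 1 \<omega>)}) = 0"
proof -
  interpret sublinear_expectation_space M H E by fact
  define a where "a k = (SUP Q\<in>P. \<integral>\<^sup>+x\<in>{real k<..real (k + 1)}. ennreal x
            \<partial>interval_measure (distribution_function Q (X 1)))" for k :: nat
  have fin: "(\<Sum>k. a k) < \<infinity>" using assms(8) by (simp add: a_def)
  have ak: "a k < top" for k
  proof -
    have "a k \<le> (\<Sum>k. a k)" using sum_le_suminf[of a "{k}"] by simp
    then show ?thesis using fin by (simp add: le_less_trans)
  qed
  define b where "b k = enn2real (a k)" for k
  have ab: "a k = ennreal (b k)" for k using ak[of k] by (simp add: b_def)
  interpret iid_sequence M H E P X b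
  proof
    show "represents M H E P" by fact
    show "independent_seq H E X" by fact
    show "X n \<in> H" if "1 \<le> n" for n using assms(4) that .
    show "0 \<le> X n \<omega>" if "1 \<le> n" "\<omega> \<in> space M" for n \<omega> using assms(5) that .
    show "identically_distributed E [X i] E [X j]" if "1 \<le> i" "1 \<le> j" for i j using assms(7) that .
    show "0 \<le> b k" for k by (simp add: b_def)
    show "summable b"
      using fin unfolding ab by (intro summable_suminf_not_top) (auto simp: b_def)
    fix Q k assume Q: "Q \<in> P"
    have prob: "prob_space Q" and sQ: "sets Q = sets M"
      using assms(3) Q by (auto simp: represents_def)
    have meas: "X 1 \<in> borel_measurable Q"
      using random_variables assms(4)[of 1] measurable_cong_sets[OF sQ refl] by auto
    have "(\<integral>\<^sup>+\<omega>. ennreal (X 1 \<omega>) * indicator {real k<..real (k + 1)} (X 1 \<omega>) \<partial>Q)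
      = (\<integral>\<^sup>+x\<in>{real k<..real (k + 1)}. ennreal x \<partial>interval_measure (distribution_function Q (X 1)))"
      by (rule nn_integral_interval_measure_distribution[OF prob meas, symmetric]) measurable
    also have "\<dots> \<le> a k" unfolding a_def using Q by (rule SUP_upper)
    finally show "(\<integral>\<^sup>+\<omega>. ennreal (X 1 \<omega>) * indicator {real k<..real (k + 1)} (X 1 \<omega>) \<partial>Q) \<le> ennreal (b k)"
      by (simp add: ab)
  qed
  have mean [measurable]: "(\<lambda>\<omega>. ereal ((\<Sum>i=1..n. X i \<omega>) / real n)) \<in> borel_measurable M" for n
    using random_variables assms(4)
    by (intro borel_measurable_ereal borel_measurable_divide borel_measurable_sum borel_measurable_const) auto
  show ?thesis
  proof (rule capacity_eq_0_if_AE)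
    fix Q assume Q: "Q \<in> P"
    from AE_limsup_mean_le[OF Q] AE_liminf_mean_ge[OF Q]
    show "AE \<omega> in Q. \<omega> \<notin> {\<omega>\<in>space M. limsup (\<lambda>n. ereal ((\<Sum>i=1..n. X i \<omega>) / real n)) > E (X 1)} \<union>
      {\<omega>\<in>space M. liminf (\<lambda>n. ereal ((\<Sum>i=1..n. X i \<omega>) / real n)) < - E (\<lambda>\<omega>. - X 1 \<omega>)}"
      by eventually_elim auto
  qed measurable
qed

end
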